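(* Let $r\in\mathbb N$ and $x\in L^r_{\infty,\infty}(\mathbb R)$ be given. Suppose that one of the following conditions holds: a) the numbers $a_1=0$, $a_2\ge 0$, $\lambda>0$ and $b\ne 0$ are such that $\|x^{(k)}\|\le\|\Psi^{(k)}_{a_1,a_2,b,\lambda}\|$ for $k\in\{0,r-1,r\}$; b) the numbers $a_1\ge 0$, $a_2=0$, $\lambda>0$ and $b\neq 0$ are such that $\|x^{(k)}\|\le\|\Psi^{(k)}_{a_1,a_2,b,\lambda}\|$ for $k\in\{0,r-2,r\}$; c) the numbers $a_1\ge 0$, $a_2\ge 0$, $\lambda>0$ and $b\ne 0$ are such that $\|x^{(k)}\|\le\|\Psi^{(k)}_{a_1,a_2,b,\lambda}\|$ for $k\in\{0,r-1,r-2,r\}$. If points $\tau$ and $\xi$ are such that $x(\tau)=\Psi_{a_1,a_2,b,\lambda}(\xi)$, then $$|x'(\tau)|\le|\Psi'_{a_1,a_2,b,\lambda}(\xi)|.$$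
   Context: $\|\cdot\|$ is the norm of $L_\infty(\mathbb R)$ (essential supremum of the absolute value). $L^r_\infty(\mathbb R)$ is the space of functions $x:\mathbb R\to\mathbb R$ such that $x^{(r-1)}$ (with $x^{(0)}=x$) is locally absolutely continuous and $x^{(r)}\in L_\infty(\mathbb R)$; $L^r_{\infty,\infty}(\mathbb R)=L^r_\infty(\mathbb R)\cap L_\infty(\mathbb R)$. For $a_1,a_2\ge 0$ put $T=a_1+a_2+2$ and define $\psi_1(a_1,a_2;t)$ on $[0,T]$ to be $0$ for $t\in[0,a_1]$, $t-a_1$ for $t\in[a_1,a_1+1]$, $1$ for $t\in[a_1+1,a_1+a_2+1]$, and $2+a_1+a_2-t$ for $t\in[a_1+a_2+1,T]$. Extend it to $[T,2T]$ by $\psi_1(a_1,a_2;t)=-\psi_1(a_1,a_2;t-T)$ and then $2T$-periodically to $\mathbb R$. For $r\in\mathbb N$, $\psi_r(a_1,a_2;\cdot)$ is the $(r-1)$-th $2T$-periodic integral of $\psi_1(a_1,a_2;\cdot)$ with zero mean over the period (so that $\psi_r'(a_1,a_2;t)=\psi_{r-1}(a_1,a_2;t)$ for $r\ge2$). For $r\in\mathbb N$, $a_1,a_2\ge0$, $\lambda>0$, $b\in\mathbb R$, $$\Psi_{a_1,a_2,b,\lambda}(t)=\Psi_{r;a_1,a_2,b,\lambda}(t)=b\left(\frac{\lambda}{2a_1+2a_2+4}\right)^{r}\psi_r\!\left(a_1,a_2;\frac{2a_1+2a_2+4}{\lambda}\,t\right),$$ which is a $\lambda$-periodic function. *)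

theory Defs
  imports
    "HOL-Analysis.Analysis"
    "HOL-Probability.Essential_Supremum"
    "HOL-Library.Real_Mod"
begin

(* The Lebesgue measure is the completed one: the r-th derivative of a function whose
   (r-1)-st derivative is locally absolutely continuous exists only almost everywhere,
   and deriv is unspecified on the exceptional null set. The complete measure makes the
   values there irrelevant, also for measurability. *)

definition Linf_norm :: "(real \<Rightarrow> real) \<Rightarrow> ereal" where
  "Linf_norm f = esssup lebesgue (\<lambda>t. ereal \<bar>f t\<bar>)"

definition Linf :: "(real \<Rightarrow> real) set" where
  "Linf = {f. f \<in> borel_measurable lebesgue \<and> Linf_norm f < \<infinity>}"

(* The pair p stands for the open interval from fst p to snd p. *)

definition abs_continuous_on_interval :: "real \<Rightarrow> real \<Rightarrow> (real \<Rightarrow> real) \<Rightarrow> bool" where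
  "abs_continuous_on_interval c d f \<longleftrightarrow>
     (\<forall>\<epsilon>>0. \<exists>\<delta>>0. \<forall>I :: (real \<times> real) set.
        finite I \<longrightarrow>
        (\<forall>p\<in>I. c \<le> fst p \<and> fst p \<le> snd p \<and> snd p \<le> d) \<longrightarrow>
        (\<forall>p\<in>I. \<forall>q\<in>I. p \<noteq> q \<longrightarrow> {fst p<..<snd p} \<inter> {fst q<..<snd q} = {}) \<longrightarrow>
        (\<Sum>p\<in>I. snd p - fst p) < \<delta> \<longrightarrow>
        (\<Sum>p\<in>I. \<bar>f (snd p) - f (fst p)\<bar>) < \<epsilon>)"

definition locally_abs_continuous :: "(real \<Rightarrow> real) \<Rightarrow> bool" where
  "locally_abs_continuous f \<longleftrightarrow> (\<forall>c d. c \<le> d \<longrightarrow> abs_continuous_on_interval c d f)"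

(* Meant for r \<ge> 1. The first condition says that the derivatives up to order r - 1
   exist everywhere. *)

definition Linf_deriv :: "nat \<Rightarrow> (real \<Rightarrow> real) set" where
  "Linf_deriv r = {x.
     (\<forall>k<r-1. \<forall>t. (deriv ^^ k) x field_differentiable at t) \<and>
     locally_abs_continuous ((deriv ^^ (r-1)) x) \<and>
     (deriv ^^ r) x \<in> Linf}"

definition psi1_base :: "real \<Rightarrow> real \<Rightarrow> real \<Rightarrow> real" where
  "psi1_base a1 a2 t =
     (if t \<le> a1 then 0
      else if t \<le> a1 + 1 then t - a1
      else if t \<le> a1 + a2 + 1 then 1
      else 2 + a1 + a2 - t)"

definition psi1 :: "real \<Rightarrow> real \<Rightarrow> real \<Rightarrow> real" where
  "psi1 a1 a2 t =
     (let T = a1 + a2 + 2; s = t rmod (2 * T)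
      in if s \<le> T then psi1_base a1 a2 s else - psi1_base a1 a2 (s - T))"

(* The antiderivative of f with zero mean over the period P. It is P-periodic when f is
   P-periodic with zero mean. LBINT from 0 to t is the signed integral, also for t < 0. *)

definition zero_mean_integral :: "real \<Rightarrow> (real \<Rightarrow> real) \<Rightarrow> real \<Rightarrow> real" where
  "zero_mean_integral P f t =
     (LBINT s=0..t. f s) - (1 / P) * (LBINT u=0..P. (LBINT s=0..u. f s))"

(* Meant for r \<ge> 1. *)

definition psi :: "nat \<Rightarrow> real \<Rightarrow> real \<Rightarrow> real \<Rightarrow> real" where
  "psi r a1 a2 = (zero_mean_integral (2 * (a1 + a2 + 2)) ^^ (r - 1)) (psi1 a1 a2)"

definition Psi :: "nat \<Rightarrow> real \<Rightarrow> real \<Rightarrow> real \<Rightarrow> real \<Rightarrow> real \<Rightarrow> real" where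
  "Psi r a1 a2 b l t =
     b * (l / (2 * a1 + 2 * a2 + 4)) ^ r * psi r a1 a2 ((2 * a1 + 2 * a2 + 4) / l * t)"

definition norms_dominated ::
    "nat set \<Rightarrow> (real \<Rightarrow> real) \<Rightarrow> (real \<Rightarrow> real) \<Rightarrow> bool" where
  "norms_dominated K x y \<longleftrightarrow>
     (\<forall>k\<in>K. Linf_norm ((deriv ^^ k) x) \<le> Linf_norm ((deriv ^^ k) y))"

end

theory Submission
  imports Defs
begin

text \<open>
Write \<open>y\<^sub>k\<close> for the rescaled derivative of order \<open>r - k\<close> of \<open>x\<close>, so that \<open>y\<^sub>k\<close> is to be compared with
\<open>\<psi>\<^sub>k\<close>. If at equal values \<open>y\<^sub>k\<close> never changes faster than \<open>\<psi>\<^sub>k\<close> and is bounded by the norm of \<open>\<psi>\<^sub>k\<close>, then the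
same holds for \<open>y\<^sub>k\<^sub>+\<^sub>1\<close>: if \<open>y\<^sub>k\<^sub>+\<^sub>1\<close> were steeper than \<open>\<psi>\<^sub>k\<^sub>+\<^sub>1\<close> at a common value, its slope \<open>y\<^sub>k\<close>
would decay no faster than \<open>\<psi>\<^sub>k\<close> does from the same height, and \<open>y\<^sub>k\<^sub>+\<^sub>1\<close> would overshoot the maximum of
\<open>\<psi>\<^sub>k\<^sub>+\<^sub>1\<close>. The bound on \<open>y\<^sub>k\<close> follows from that on \<open>y\<^sub>k\<^sub>+\<^sub>1\<close> by a scaling argument unless \<open>\<psi>\<^sub>k\<close> has a
plateau at its maximum. That happens only for \<open>k = 1\<close>, \<open>a\<^sub>2 > 0\<close> and \<open>k = 2\<close>, \<open>a\<^sub>1 > 0\<close>, where the bound is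
a hypothesis.

The induction starts from the fact that \<open>y\<^sub>1\<close> is Lipschitz, i.e. that a locally absolutely continuous
function with almost everywhere bounded derivative is Lipschitz. This rests on Lebesgue's theorem that such
a function is differentiable almost everywhere, proved here by Vitali coverings.
\<close>

text \<open>Information has to travel in two directions: domination is passed up from
  \<open>y\<^sub>1\<close>, the only function whose steepness is known at the outset, whereas bounds
  are passed down from \<open>y\<^sub>r\<close>, since the norms of most intermediate derivatives
  are not given. The two are reconciled by an induction statement that is conditional: if
  \<open>y\<^sub>k\<close> satisfies a bound, then it is dominated. The bound is supplied one level
  higher, where the scaling argument applies the same conditional statement to a larger bound and
  refutes it. For this the supremum of \<open>|y\<^sub>k|\<close> must be finite, which is a
  separate, purely qualitative estimate. Only two orders are exceptional, whatever \<open>r\<close>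
  is, because a plateau at the top of \<open>\<psi>\<^sub>k\<^sub>+\<^sub>1\<close> arises where
  \<open>\<psi>\<^sub>k\<close> vanishes on an interval. Only \<open>\<psi>\<^sub>1\<close> does so,
  on intervals of length \<open>a\<^sub>1\<close>; its antiderivatives have isolated zeros. The
  other plateau, of length \<open>a\<^sub>2\<close>, belongs to \<open>\<psi>\<^sub>1\<close>
  itself.\<close>

section \<open>Absolutely continuous functions\<close>

text \<open>\<open>E\<close> need not be measurable, so its outer measure is estimated through a
  measurable superset \<open>Z\<close>: a countable disjoint Vitali family together with the null
  set that it misses. Finitely many of its intervals carry all but \<epsilon> of the total
  length.\<close>

lemma vitali_intervals:
  fixes E U :: "real set"
  assumes fine: "\<And>t \<rho>. t \<in> E \<Longrightarrow> \<rho> > 0 \<Longrightarrow> \<exists>u v. u \<le> t \<and> t \<le> v \<and> u < v \<and> v - u < \<rho> \<and> R u v"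
    and "open U" "E \<subseteq> U" "U \<in> lmeasurable" "\<epsilon> > 0"
  obtains F Z where "finite F" "\<And>u v. (u, v) \<in> F \<Longrightarrow> u < v \<and> {u..v} \<subseteq> U \<and> R u v"
    "\<And>p q. p \<in> F \<Longrightarrow> q \<in> F \<Longrightarrow> p \<noteq> q \<Longrightarrow> {fst p..snd p} \<inter> {fst q..snd q} = {}"
    "Z \<in> lmeasurable" "E \<subseteq> Z" "measure lebesgue Z \<le> (\<Sum>p\<in>F. snd p - fst p) + \<epsilon>"
proof -
  define K where "K = {p. fst p < snd p \<and> {fst p..snd p} \<subseteq> U \<and> R (fst p) (snd p)}"
  define a r where "a p = (fst p + snd p) / 2" and "r p = (snd p - fst p) / 2" for p :: "real \<times> real"
  have ball: "cball (a p) (r p) = {fst p..snd p}" for p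
    unfolding a_def r_def cball_eq_atLeastAtMost by (simp add: field_simps)
  have "\<exists>p. p \<in> K \<and> t \<in> cball (a p) (r p) \<and> r p < d" if t: "t \<in> E" and d: "d > 0" for t d
  proof -
    obtain e where e: "e > 0" "ball t e \<subseteq> U"
      using t assms by (meson openE subsetD)
    obtain u v where uv: "u \<le> t" "t \<le> v" "u < v" "v - u < min d e" "R u v"
      using fine[OF t, of "min d e"] d e by auto
    have "{u..v} \<subseteq> U"
      using uv e by (fastforce simp: dist_real_def)
    then have "(u, v) \<in> K"
      using uv by (simp add: K_def)
    moreover have "t \<in> cball (a (u, v)) (r (u, v))" "r (u, v) < d"
      unfolding ball using uv d by (auto simp: r_def field_simps)
    ultimately show ?thesis by blast
  qed
  then obtain C where C: "countable C" "C \<subseteq> K"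
    "pairwise (\<lambda>i j. disjnt (cball (a i) (r i)) (cball (a j) (r j))) C"
    "negligible (E - (\<Union>i\<in>C. cball (a i) (r i)))"
    by (rule Vitali_covering_theorem_cballs[of K r E a, rotated]) (auto simp: K_def r_def)
  define I where "I p = {fst p..snd p}" for p :: "real \<times> real"
  have CI: "pairwise (\<lambda>i j. disjnt (I i) (I j)) C" "negligible (E - (\<Union>i\<in>C. I i))"
    using C unfolding ball I_def by auto
  have meas: "(\<Union>i\<in>C. I i) \<in> lmeasurable"
  proof (rule fmeasurableI2[OF \<open>U \<in> lmeasurable\<close>])
    show "(\<Union>i\<in>C. I i) \<subseteq> U" using C(2) by (auto simp: K_def I_def)
    show "(\<Union>i\<in>C. I i) \<in> sets lebesgue"
      by (intro sets.countable_UN'' C) (auto simp: I_def)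
  qed
  have "\<exists>F. finite F \<and> F \<subseteq> C \<and> measure lebesgue (\<Union>i\<in>C. I i) \<le> (\<Sum>p\<in>F. snd p - fst p) + \<epsilon>"
  proof -
    have mI: "measure lebesgue (I i) = snd i - fst i" if "i \<in> C" for i
      using that C(2) by (auto simp: I_def K_def)
    have mF: "measure lebesgue (\<Union>i\<in>F. I i) = (\<Sum>p\<in>F. snd p - fst p)" if "finite F" "F \<subseteq> C" for F
    proof -
      have "measure lebesgue (\<Union>i\<in>F. I i) = (\<Sum>p\<in>F. measure lebesgue (I p))"
        by (rule measure_UNION') (use that CI(1) in \<open>auto simp: I_def intro: pairwise_subset\<close>)
      also have "\<dots> = (\<Sum>p\<in>F. snd p - fst p)"
        by (rule sum.cong) (use that mI in auto)
      finally show ?thesis .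
    qed
    obtain D' where D': "D' \<subseteq> I ` C" "finite D'" "measure lebesgue (\<Union>(I ` C)) - \<epsilon> < measure lebesgue (\<Union>D')"
    proof (rule measure_countable_Union_approachable[of "I ` C" \<epsilon> "measure lebesgue (\<Union>i\<in>C. I i)"])
      show "measure lebesgue (\<Union>D') \<le> measure lebesgue (\<Union>i\<in>C. I i)" if "D' \<subseteq> I ` C" "finite D'" for D'
        by (rule measure_mono_fmeasurable[OF _ _ meas]) (use that in \<open>auto simp: I_def intro!: sets.finite_Union\<close>)
    qed (use C \<open>\<epsilon> > 0\<close> in \<open>auto simp: I_def\<close>)
    then obtain F where "F \<subseteq> C" "finite F" "D' = I ` F"
      by (meson finite_subset_image)
    then show ?thesis
      using D'(3) mF[of F] by (intro exI[of _ F]) auto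
  qed
  then obtain F where F: "finite F" "F \<subseteq> C" "measure lebesgue (\<Union>i\<in>C. I i) \<le> (\<Sum>p\<in>F. snd p - fst p) + \<epsilon>"
    by blast
  define N where "N = E - (\<Union>i\<in>C. I i)"
  define Z where "Z = (\<Union>i\<in>C. I i) \<union> N"
  have "N \<in> null_sets lebesgue"
    using CI(2) by (simp add: N_def negligible_iff_null_sets)
  then have "measure lebesgue Z = measure lebesgue (\<Union>i\<in>C. I i)" "Z \<in> lmeasurable"
    using meas unfolding Z_def
    by (auto simp: measure_Un_null_set fmeasurableD negligible_iff_null_sets[symmetric] negligible_imp_measurable intro!: fmeasurable.Un)
  with F(1,3) show thesis
  proof (intro that[of F Z])
    show "u < v \<and> {u..v} \<subseteq> U \<and> R u v" if "(u, v) \<in> F" for u v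
    proof -
      have "(u, v) \<in> K" using that F(2) C(2) by blast
      then show ?thesis by (simp add: K_def)
    qed
    show "{fst p..snd p} \<inter> {fst q..snd q} = {}" if "p \<in> F" "q \<in> F" "p \<noteq> q" for p q
      using that F(2) CI(1) unfolding I_def pairwise_def disjnt_def by blast
  qed (use F in \<open>auto simp: Z_def N_def\<close>)
qed

text \<open>The identity for all \<open>f\<close> at once includes \<open>f t = t\<close>, which yields the total length of the gaps.\<close>

lemma interval_gaps:
  fixes F :: "(real \<times> real) set"
  assumes "finite F" "\<And>p. p \<in> F \<Longrightarrow> u \<le> fst p \<and> fst p < snd p \<and> snd p \<le> v"
    "\<And>p q. p \<in> F \<Longrightarrow> q \<in> F \<Longrightarrow> p \<noteq> q \<Longrightarrow> {fst p..snd p} \<inter> {fst q..snd q} = {}" "u \<le> v"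
  shows "\<exists>G. finite G \<and> (\<forall>p\<in>G. u \<le> fst p \<and> fst p \<le> snd p \<and> snd p \<le> v) \<and>
    (\<forall>p\<in>G. \<forall>q\<in>G. p \<noteq> q \<longrightarrow> {fst p<..<snd p} \<inter> {fst q<..<snd q} = {}) \<and>
    (\<forall>f :: real \<Rightarrow> real. (\<Sum>p\<in>G. f (snd p) - f (fst p)) = f v - f u - (\<Sum>p\<in>F. f (snd p) - f (fst p)))"
  using assms
proof (induction "card F" arbitrary: F v)
  case 0
  then have "F = {}" by simp
  then show ?case using \<open>u \<le> v\<close> by (intro exI[of _ "{(u, v)}"]) auto
next
  case (Suc n)
  then have F: "finite F" "F \<noteq> {}" by auto
  \<comment> \<open>The rightmost interval. Beyond it lies the single gap from \<open>snd p\<close>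
    to \<open>v\<close>; the induction hypothesis handles the part from \<open>u\<close> to
    \<open>fst p\<close>, which contains all the other intervals.\<close>
  define p where "p = arg_min_on (\<lambda>q. - fst q) F"
  have p: "p \<in> F" "\<And>q. q \<in> F \<Longrightarrow> fst q \<le> fst p"
    unfolding p_def using arg_min_if_finite(1)[OF F] arg_min_least[OF F, of _ "\<lambda>q. - fst q"] by auto
  have pv: "u \<le> fst p" "fst p < snd p" "snd p \<le> v"
    using Suc.prems p by auto
  have left: "snd q \<le> fst p" if "q \<in> F - {p}" for q
  proof (rule ccontr)
    assume "\<not> snd q \<le> fst p"
    moreover have "{fst p..snd p} \<inter> {fst q..snd q} = {}"
      using Suc.prems(3)[of p q] that p by auto
    moreover have "fst q \<le> fst p" using that p by auto
    ultimately have "fst p \<in> {fst p..snd p} \<inter> {fst q..snd q}" using pv by auto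
    then show False using \<open>{fst p..snd p} \<inter> {fst q..snd q} = {}\<close> by blast
  qed
  have "\<exists>G. finite G \<and> (\<forall>q\<in>G. u \<le> fst q \<and> fst q \<le> snd q \<and> snd q \<le> fst p) \<and>
    (\<forall>p\<in>G. \<forall>q\<in>G. p \<noteq> q \<longrightarrow> {fst p<..<snd p} \<inter> {fst q<..<snd q} = {}) \<and>
    (\<forall>f :: real \<Rightarrow> real. (\<Sum>p\<in>G. f (snd p) - f (fst p)) = f (fst p) - f u - (\<Sum>p\<in>F - {p}. f (snd p) - f (fst p)))"
  proof (rule Suc.hyps(1))
    show "n = card (F - {p})" using Suc.hyps(2) p Suc.prems(1) by simp
    show "finite (F - {p})" using Suc.prems(1) by simp
    show "u \<le> fst p" by fact
    show "u \<le> fst q \<and> fst q < snd q \<and> snd q \<le> fst p" if "q \<in> F - {p}" for q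
      using Suc.prems(2)[of q] left[OF that] that by simp
    show "{fst q..snd q} \<inter> {fst q'..snd q'} = {}" if "q \<in> F - {p}" "q' \<in> F - {p}" "q \<noteq> q'" for q q'
      using Suc.prems(3)[of q q'] that by simp
  qed
  then obtain G where fin: "finite G"
    and G': "\<forall>q\<in>G. u \<le> fst q \<and> fst q \<le> snd q \<and> snd q \<le> fst p"
      "\<forall>p\<in>G. \<forall>q\<in>G. p \<noteq> q \<longrightarrow> {fst p<..<snd p} \<inter> {fst q<..<snd q} = {}"
      "\<forall>f :: real \<Rightarrow> real. (\<Sum>p\<in>G. f (snd p) - f (fst p)) = f (fst p) - f u - (\<Sum>p\<in>F - {p}. f (snd p) - f (fst p))"
    by (elim exE conjE)
  note G = fin G'[rule_format]
  have notin: "(snd p, v) \<notin> G"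
    using G(2)[of "(snd p, v)"] pv by auto
  show ?case
  proof (intro exI[of _ "insert (snd p, v) G"] conjI allI)
    fix f :: "real \<Rightarrow> real"
    show "(\<Sum>p\<in>insert (snd p, v) G. f (snd p) - f (fst p)) = f v - f u - (\<Sum>p\<in>F. f (snd p) - f (fst p))"
      using notin G(1) G(4)[of f] p(1) Suc.prems(1) by (simp add: sum.remove)
  next
    have gap: "{snd p<..<v} \<inter> {fst q<..<snd q} = {}" if "q \<in> G" for q
      using G(2)[OF that] pv by (auto simp: disjoint_iff)
    show "\<forall>q\<in>insert (snd p, v) G. \<forall>q'\<in>insert (snd p, v) G. q \<noteq> q' \<longrightarrow> {fst q<..<snd q} \<inter> {fst q'<..<snd q'} = {}"
    proof (intro ballI impI)
      fix q q' assume q: "q \<in> insert (snd p, v) G" "q' \<in> insert (snd p, v) G" "q \<noteq> q'"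
      then consider "q = (snd p, v)" "q' \<in> G" | "q' = (snd p, v)" "q \<in> G" | "q \<in> G" "q' \<in> G" by blast
      then show "{fst q<..<snd q} \<inter> {fst q'<..<snd q'} = {}"
      proof cases
        case 1
        then show ?thesis using gap[of q'] by simp
      next
        case 2
        then show ?thesis using gap[of q] by (simp add: Int_commute)
      next
        case 3
        then show ?thesis using G(3) q by blast
      qed
    qed
    show "finite (insert (snd p, v) G)" using G(1) by simp
    show "\<forall>q\<in>insert (snd p, v) G. u \<le> fst q \<and> fst q \<le> snd q \<and> snd q \<le> v"
    proof (intro ballI)
      fix q assume "q \<in> insert (snd p, v) G"
      then show "u \<le> fst q \<and> fst q \<le> snd q \<and> snd q \<le> v"
        using G(2)[of q] pv by (cases "q \<in> G") auto
    qed
  qed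
qed

lemma sum_lengths_le_measure:
  fixes F :: "(real \<times> real) set"
  assumes "finite F" "\<And>p. p \<in> F \<Longrightarrow> fst p < snd p"
    "\<And>p q. p \<in> F \<Longrightarrow> q \<in> F \<Longrightarrow> p \<noteq> q \<Longrightarrow> {fst p..snd p} \<inter> {fst q..snd q} = {}"
    "U \<in> lmeasurable" "\<And>p. p \<in> F \<Longrightarrow> {fst p<..<snd p} \<subseteq> U"
  shows "(\<Sum>p\<in>F. snd p - fst p) \<le> measure lebesgue U"
proof -
  have "{fst p<..<snd p} \<inter> {fst q<..<snd q} = {}" if "p \<in> F" "q \<in> F" "p \<noteq> q" for p q
  proof -
    have "{fst p<..<snd p} \<subseteq> {fst p..snd p}" "{fst q<..<snd q} \<subseteq> {fst q..snd q}" by auto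
    then show ?thesis using assms(3)[OF that] by blast
  qed
  then have "pairwise (\<lambda>p q. disjnt {fst p<..<snd p} {fst q<..<snd q}) F"
    by (simp add: pairwise_def disjnt_def)
  then have "measure lebesgue (\<Union>p\<in>F. {fst p<..<snd p}) = (\<Sum>p\<in>F. measure lebesgue {fst p<..<snd p})"
    using assms(1) by (intro measure_UNION') auto
  also have "\<dots> = (\<Sum>p\<in>F. snd p - fst p)"
    by (rule sum.cong) (use assms(2) in \<open>auto simp: less_imp_le\<close>)
  finally have "(\<Sum>p\<in>F. snd p - fst p) = measure lebesgue (\<Union>p\<in>F. {fst p<..<snd p})" ..
  also have "\<dots> \<le> measure lebesgue U"
    by (rule measure_mono_fmeasurable[OF UN_least]) (use assms(1,4,5) in auto)
  finally show ?thesis .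
qed

section \<open>Differentiability almost everywhere of absolutely continuous functions\<close>

lemma abs_continuous_onE:
  assumes "abs_continuous_on_interval c d f" "\<epsilon> > 0"
  obtains \<delta> where "\<delta> > 0"
    "\<And>I. finite I \<Longrightarrow> (\<forall>p\<in>I. c \<le> fst p \<and> fst p \<le> snd p \<and> snd p \<le> d) \<Longrightarrow>
      (\<forall>p\<in>I. \<forall>q\<in>I. p \<noteq> q \<longrightarrow> {fst p<..<snd p} \<inter> {fst q<..<snd q} = {}) \<Longrightarrow>
      (\<Sum>p\<in>I. snd p - fst p) < \<delta> \<Longrightarrow> (\<Sum>p\<in>I. \<bar>f (snd p) - f (fst p)\<bar>) < \<epsilon>"
proof -
  from assms obtain \<delta> where "\<delta> > 0" and \<delta>: "\<forall>I. finite I \<longrightarrow>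
        (\<forall>p\<in>I. c \<le> fst p \<and> fst p \<le> snd p \<and> snd p \<le> d) \<longrightarrow>
        (\<forall>p\<in>I. \<forall>q\<in>I. p \<noteq> q \<longrightarrow> {fst p<..<snd p} \<inter> {fst q<..<snd q} = {}) \<longrightarrow>
        (\<Sum>p\<in>I. snd p - fst p) < \<delta> \<longrightarrow>
        (\<Sum>p\<in>I. \<bar>f (snd p) - f (fst p)\<bar>) < \<epsilon>"
    unfolding abs_continuous_on_interval_def by blast
  show thesis by (rule that[OF \<open>\<delta> > 0\<close>]) (use \<delta> in simp)
qed

lemma Icc_subset_IooD: "{u..v} \<subseteq> {c<..<d} \<Longrightarrow> u \<le> v \<Longrightarrow> c < u \<and> v < (d :: real)"
  by (simp add: subset_iff)

text \<open>Monotonicity of \<open>f\<close> is not available, so the two families of intervals are nested: disjoint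
  intervals of slope at most \<open>q\<close> that almost fill a tight open cover of \<open>E\<close>, and inside them disjoint
  intervals of slope at least \<open>p\<close>. The gaps between the families have small total length, so by absolute
  continuity both give nearly the same total increment of \<open>f\<close>.\<close>

lemma two_slopes_negligible:
  assumes ac: "abs_continuous_on_interval c d f" and "q < p" and E: "E \<subseteq> {c<..<d}"
    and lo: "\<And>t \<rho>. t \<in> E \<Longrightarrow> \<rho> > 0 \<Longrightarrow> \<exists>u v. u \<le> t \<and> t \<le> v \<and> u < v \<and> v - u < \<rho> \<and> f v - f u \<le> q * (v - u)"
    and hi: "\<And>t \<rho>. t \<in> E \<Longrightarrow> \<rho> > 0 \<Longrightarrow> \<exists>u v. u \<le> t \<and> t \<le> v \<and> u < v \<and> v - u < \<rho> \<and> p * (v - u) \<le> f v - f u"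
  shows "negligible E"
proof -
  \<comment> \<open>\<open>m\<close> is the outer measure of \<open>E\<close>.\<close>
  define A where "A = measure lebesgue ` {Z \<in> lmeasurable. E \<subseteq> Z}"
  define m where "m = Inf A"
  have "{c<..<d} \<in> {Z \<in> lmeasurable. E \<subseteq> Z}" using E by simp
  then have "A \<noteq> {}" unfolding A_def by blast
  have bdd: "bdd_below A" unfolding A_def by (rule bdd_belowI2[of _ 0]) simp
  have m_le: "m \<le> measure lebesgue Z" if "Z \<in> lmeasurable" "E \<subseteq> Z" for Z
    unfolding m_def by (rule cInf_lower[OF _ bdd]) (use that in \<open>auto simp: A_def\<close>)
  have approx: "\<exists>Z\<in>lmeasurable. E \<subseteq> Z \<and> measure lebesgue Z < m + e" if "e > 0" for e
    using cInf_lessD[OF \<open>A \<noteq> {}\<close>, of "m + e"] that by (auto simp: A_def m_def)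
  have "m \<ge> 0" unfolding m_def using \<open>A \<noteq> {}\<close> by (rule cInf_greatest) (auto simp: A_def)
  have False if "m > 0"
  proof -
    define \<eta> where "\<eta> = (p - q) * m / 4"
    have "\<eta> > 0" using that \<open>q < p\<close> by (simp add: \<eta>_def)
    obtain \<delta> where "\<delta> > 0" and \<delta>: "\<And>I. finite I \<Longrightarrow> (\<forall>p\<in>I. c \<le> fst p \<and> fst p \<le> snd p \<and> snd p \<le> d) \<Longrightarrow>
        (\<forall>p\<in>I. \<forall>q\<in>I. p \<noteq> q \<longrightarrow> {fst p<..<snd p} \<inter> {fst q<..<snd q} = {}) \<Longrightarrow>
        (\<Sum>p\<in>I. snd p - fst p) < \<delta> \<Longrightarrow> (\<Sum>p\<in>I. \<bar>f (snd p) - f (fst p)\<bar>) < \<eta>"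
      by (rule abs_continuous_onE[OF ac \<open>\<eta> > 0\<close>]) blast
    \<comment> \<open>The three bounds give, in turn, \<open>L \<ge> 3 * m / 4\<close>, a total gap
      length \<open>L - L' \<le> 2 * \<epsilon> < \<delta>\<close>, and
      \<open>\<bar>p\<bar> * (2 * \<epsilon>) \<le> \<eta>\<close>. The contradiction at the end is
      \<open>3 * \<eta> \<le> (p - q) * L < 2 * \<eta>\<close>.\<close>
    define \<epsilon> where "\<epsilon> = min (m / 4) (min (\<delta> / 4) ((p - q) * m / (8 * (\<bar>p\<bar> + 1))))"
    have \<epsilon>: "\<epsilon> > 0" "\<epsilon> \<le> m / 4" "\<epsilon> \<le> \<delta> / 4" "\<epsilon> \<le> (p - q) * m / (8 * (\<bar>p\<bar> + 1))"
      using that \<open>\<delta> > 0\<close> \<open>q < p\<close> unfolding \<epsilon>_def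
      by (auto intro!: divide_pos_pos simp del: le_divide_eq_numeral1)
    obtain U where U: "open U" "E \<subseteq> U" "U \<in> lmeasurable" "measure lebesgue U < m + \<epsilon>" "U \<subseteq> {c<..<d}"
    proof -
      obtain Z where Z: "Z \<in> lmeasurable" "E \<subseteq> Z" "measure lebesgue Z < m + \<epsilon> / 2"
        using approx[of "\<epsilon> / 2"] \<epsilon> by auto
      obtain T where T: "open T" "Z \<subseteq> T" "T - Z \<in> lmeasurable" "emeasure lebesgue (T - Z) < ennreal (\<epsilon> / 2)"
        using sets_lebesgue_outer_open[of Z "\<epsilon> / 2"] Z(1) \<epsilon>(1) by (auto simp: fmeasurableD)
      have "measure lebesgue (T - Z) < \<epsilon> / 2"
        using T(3,4) \<epsilon>(1) by (simp add: emeasure_eq_measure2 ennreal_less_iff)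
      moreover have eq: "T = Z \<union> (T - Z)" using T by blast
      have "T \<in> lmeasurable" by (subst eq, rule fmeasurable.Un) (use Z T in auto)
      moreover have "measure lebesgue T \<le> measure lebesgue Z + measure lebesgue (T - Z)"
        by (subst eq, rule measure_Un_le) (use Z T in \<open>auto simp: fmeasurableD\<close>)
      moreover have "measure lebesgue (T \<inter> {c<..<d}) \<le> measure lebesgue T"
        by (rule measure_mono_fmeasurable) (use \<open>T \<in> lmeasurable\<close> in \<open>auto simp: fmeasurableD\<close>)
      ultimately have "measure lebesgue (T \<inter> {c<..<d}) < m + \<epsilon>"
        using Z(3) by linarith
      then show thesis
        using T Z E \<open>T \<in> lmeasurable\<close> by (intro that[of "T \<inter> {c<..<d}"]) (auto intro: fmeasurable.Int)
    qed
    obtain F Z where F: "finite F" "\<And>u v. (u, v) \<in> F \<Longrightarrow> u < v \<and> {u..v} \<subseteq> U \<and> f v - f u \<le> q * (v - u)"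
      and disj: "\<And>p q. p \<in> F \<Longrightarrow> q \<in> F \<Longrightarrow> p \<noteq> q \<Longrightarrow> {fst p..snd p} \<inter> {fst q..snd q} = {}"
      and Z: "Z \<in> lmeasurable" "E \<subseteq> Z" "measure lebesgue Z \<le> (\<Sum>p\<in>F. snd p - fst p) + \<epsilon>"
      by (rule vitali_intervals[of E "\<lambda>u v. f v - f u \<le> q * (v - u)" U \<epsilon>]) (use lo U \<epsilon> in blast)+
    define L where "L = (\<Sum>p\<in>F. snd p - fst p)"
    have L: "m - \<epsilon> \<le> L" using m_le[OF Z(1,2)] Z(3) by (simp add: L_def)
    define U' where "U' = (\<Union>p\<in>F. {fst p<..<snd p})"
    have U': "open U'" "U' \<in> lmeasurable" unfolding U'_def using F(1) by auto
    have "U' \<subseteq> U" unfolding U'_def using F(2) by fastforce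
    have LU': "L \<le> measure lebesgue U'"
      unfolding L_def by (rule sum_lengths_le_measure) (use F disj U' in \<open>auto simp: U'_def\<close>)
    \<comment> \<open>Containment in a single interval of \<open>F\<close> is made part of the
      relation, so that each interval of the second family can be assigned to one of the
      first.\<close>
    define R' where "R' u v \<longleftrightarrow> p * (v - u) \<le> f v - f u \<and> (\<exists>I\<in>F. fst I \<le> u \<and> v \<le> snd I)" for u v
    have R': "\<exists>u v. u \<le> t \<and> t \<le> v \<and> u < v \<and> v - u < \<rho> \<and> R' u v" if t: "t \<in> E \<inter> U'" and \<rho>: "\<rho> > 0" for t \<rho>
    proof -
      obtain I where I: "I \<in> F" "fst I < t" "t < snd I" using t by (auto simp: U'_def)
      define \<rho>' where "\<rho>' = min \<rho> (min (t - fst I) (snd I - t))"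
      have "\<rho>' > 0" using \<rho> I by (simp add: \<rho>'_def)
      then obtain u v where "u \<le> t" "t \<le> v" "u < v" "v - u < \<rho>'" "p * (v - u) \<le> f v - f u"
        using hi t by blast
      then show ?thesis
        using I by (intro exI[of _ u] exI[of _ v]) (auto simp: R'_def \<rho>'_def intro!: bexI[of _ I])
    qed
    obtain F' Z' where F': "finite F'" "\<And>u v. (u, v) \<in> F' \<Longrightarrow> u < v \<and> {u..v} \<subseteq> U' \<and> R' u v"
      and disj': "\<And>p q. p \<in> F' \<Longrightarrow> q \<in> F' \<Longrightarrow> p \<noteq> q \<Longrightarrow> {fst p..snd p} \<inter> {fst q..snd q} = {}"
      and Z': "Z' \<in> lmeasurable" "E \<inter> U' \<subseteq> Z'" "measure lebesgue Z' \<le> (\<Sum>p\<in>F'. snd p - fst p) + \<epsilon>"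
      by (rule vitali_intervals[of "E \<inter> U'" R' U' \<epsilon>]) (use R' U' \<epsilon> in blast)+
    define L' where "L' = (\<Sum>p\<in>F'. snd p - fst p)"
    \<comment> \<open>\<open>E\<close> is covered by \<open>Z'\<close> and \<open>U - U'\<close>,
      and the latter is small: \<open>U\<close> has measure less than \<open>m + \<epsilon>\<close>,
      \<open>U'\<close> at least \<open>L\<close>.\<close>
    have "L - L' \<le> 2 * \<epsilon>"
    proof -
      have "m \<le> measure lebesgue (Z' \<union> (U - U'))"
        by (rule m_le) (use Z' U U' in \<open>auto intro!: fmeasurable.Un fmeasurable.Diff\<close>)
      also have "\<dots> \<le> measure lebesgue Z' + measure lebesgue (U - U')"
        by (rule measure_Un_le) (use Z' U U' in \<open>auto simp: fmeasurableD\<close>)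
      also have "measure lebesgue (U - U') = measure lebesgue U - measure lebesgue U'"
        by (rule measurable_measure_Diff) (use U U' \<open>U' \<subseteq> U\<close> in \<open>auto simp: fmeasurableD\<close>)
      finally show ?thesis using LU' U(4) Z'(3) by (simp add: L'_def)
    qed
    define S where "S I = {J \<in> F'. fst I \<le> fst J \<and> snd J \<le> snd I}" for I :: "real \<times> real"
    have "\<forall>I\<in>F. \<exists>G. finite G \<and> (\<forall>p\<in>G. fst I \<le> fst p \<and> fst p \<le> snd p \<and> snd p \<le> snd I) \<and>
      (\<forall>p\<in>G. \<forall>q\<in>G. p \<noteq> q \<longrightarrow> {fst p<..<snd p} \<inter> {fst q<..<snd q} = {}) \<and>
      (\<forall>f :: real \<Rightarrow> real. (\<Sum>p\<in>G. f (snd p) - f (fst p)) = f (snd I) - f (fst I) - (\<Sum>p\<in>S I. f (snd p) - f (fst p)))"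
    proof
      fix I assume "I \<in> F"
      then have "fst I \<le> snd I" using F(2)[of "fst I" "snd I"] by simp
      moreover have "fst J < snd J" if "J \<in> F'" for J using F'(2)[of "fst J" "snd J"] that by simp
      ultimately show "\<exists>G. finite G \<and> (\<forall>p\<in>G. fst I \<le> fst p \<and> fst p \<le> snd p \<and> snd p \<le> snd I) \<and>
      (\<forall>p\<in>G. \<forall>q\<in>G. p \<noteq> q \<longrightarrow> {fst p<..<snd p} \<inter> {fst q<..<snd q} = {}) \<and>
      (\<forall>f :: real \<Rightarrow> real. (\<Sum>p\<in>G. f (snd p) - f (fst p)) = f (snd I) - f (fst I) - (\<Sum>p\<in>S I. f (snd p) - f (fst p)))"
      proof (intro interval_gaps)
        show "{fst p..snd p} \<inter> {fst q..snd q} = {}" if "p \<in> S I" "q \<in> S I" "p \<noteq> q" for p q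
          by (rule disj') (use that in \<open>auto simp: S_def\<close>)
      qed (use F'(1) in \<open>simp_all add: S_def\<close>)
    qed
    then obtain G where "\<forall>I\<in>F. finite (G I) \<and> (\<forall>p\<in>G I. fst I \<le> fst p \<and> fst p \<le> snd p \<and> snd p \<le> snd I) \<and>
      (\<forall>p\<in>G I. \<forall>q\<in>G I. p \<noteq> q \<longrightarrow> {fst p<..<snd p} \<inter> {fst q<..<snd q} = {}) \<and>
      (\<forall>f :: real \<Rightarrow> real. (\<Sum>p\<in>G I. f (snd p) - f (fst p)) = f (snd I) - f (fst I) - (\<Sum>p\<in>S I. f (snd p) - f (fst p)))"
      by (rule bchoice[THEN exE])
    then have G: "finite (G I)" "\<And>p. p \<in> G I \<Longrightarrow> fst I \<le> fst p \<and> fst p \<le> snd p \<and> snd p \<le> snd I"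
      "\<And>p q. p \<in> G I \<Longrightarrow> q \<in> G I \<Longrightarrow> p \<noteq> q \<Longrightarrow> {fst p<..<snd p} \<inter> {fst q<..<snd q} = {}"
      "\<And>f :: real \<Rightarrow> real. (\<Sum>p\<in>G I. f (snd p) - f (fst p)) = f (snd I) - f (fst I) - (\<Sum>p\<in>S I. f (snd p) - f (fst p))"
      if "I \<in> F" for I
      using that by simp_all
    have only: "I = J" if "I \<in> F" "J \<in> F" "fst I \<le> s" "s \<le> snd I" "fst J \<le> s" "s \<le> snd J" for I J s
    proof (rule ccontr)
      assume "I \<noteq> J"
      moreover have "s \<in> {fst I..snd I} \<inter> {fst J..snd J}" using that by simp
      ultimately show False using disj[OF that(1,2)] by simp
    qed
    have F'S: "F' = (\<Union>I\<in>F. S I)"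
    proof
      show "F' \<subseteq> (\<Union>I\<in>F. S I)"
      proof
        fix J assume J: "J \<in> F'"
        then show "J \<in> (\<Union>I\<in>F. S I)" using F'(2)[of "fst J" "snd J"] by (auto simp: R'_def S_def)
      qed
    qed (auto simp: S_def)
    have SI: "S I \<inter> S J = {}" if "I \<in> F" "J \<in> F" "I \<noteq> J" for I J
    proof (rule ccontr)
      assume "S I \<inter> S J \<noteq> {}"
      then obtain K where K: "K \<in> F'" "fst I \<le> fst K" "snd K \<le> snd I" "fst J \<le> fst K" "snd K \<le> snd J"
        by (auto simp: S_def)
      moreover have "fst K < snd K" using K(1) F'(2)[of "fst K" "snd K"] by simp
      ultimately show False using only[of I J "fst K"] that by auto
    qed
    \<comment> \<open>The gaps that the second family leaves inside the first. By telescoping, the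
      increments over them sum to the difference of the two totals.\<close>
    define H where "H = (\<Union>I\<in>F. G I)"
    have finH: "finite H" unfolding H_def using F(1) G(1) by blast
    have GI: "G I \<inter> G J = {}" if "I \<in> F" "J \<in> F" "I \<noteq> J" for I J
    proof (rule ccontr)
      assume "G I \<inter> G J \<noteq> {}"
      then obtain K where "K \<in> G I" "K \<in> G J" by blast
      then show False using only[of I J "fst K"] that G(2)[of I K] G(2)[of J K] by auto
    qed
    have sumH: "(\<Sum>p\<in>H. g (snd p) - g (fst p)) = (\<Sum>p\<in>F. g (snd p) - g (fst p)) - (\<Sum>p\<in>F'. g (snd p) - g (fst p))"
      for g :: "real \<Rightarrow> real"
    proof -
      have "(\<Sum>p\<in>H. g (snd p) - g (fst p)) = (\<Sum>I\<in>F. \<Sum>p\<in>G I. g (snd p) - g (fst p))"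
        unfolding H_def by (rule sum.UNION_disjoint) (use F(1) G(1) GI in auto)
      also have "\<dots> = (\<Sum>I\<in>F. g (snd I) - g (fst I) - (\<Sum>p\<in>S I. g (snd p) - g (fst p)))"
        using G(4) by (intro sum.cong) auto
      also have "\<dots> = (\<Sum>p\<in>F. g (snd p) - g (fst p)) - (\<Sum>I\<in>F. \<Sum>p\<in>S I. g (snd p) - g (fst p))"
        by (simp add: sum_subtractf)
      also have "(\<Sum>I\<in>F. \<Sum>p\<in>S I. g (snd p) - g (fst p)) = (\<Sum>p\<in>F'. g (snd p) - g (fst p))"
        by (subst F'S, rule sum.UNION_disjoint[symmetric]) (use F(1) F'(1) SI in \<open>auto simp: S_def\<close>)
      finally show ?thesis .
    qed
    have lenH: "(\<Sum>p\<in>H. snd p - fst p) = L - L'"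
      using sumH[of "\<lambda>x. x"] by (simp add: L_def L'_def)
    have "(\<Sum>p\<in>H. \<bar>f (snd p) - f (fst p)\<bar>) < \<eta>"
    proof (rule \<delta>[OF finH])
      show "\<forall>p\<in>H. c \<le> fst p \<and> fst p \<le> snd p \<and> snd p \<le> d"
      proof
        fix K assume "K \<in> H"
        then obtain I where I: "I \<in> F" "K \<in> G I" by (auto simp: H_def)
        then have "{fst I..snd I} \<subseteq> {c<..<d}" "fst I < snd I"
          using F(2)[of "fst I" "snd I"] U(5) by auto
        then show "c \<le> fst K \<and> fst K \<le> snd K \<and> snd K \<le> d"
          using G(2)[OF I] Icc_subset_IooD[of "fst I" "snd I" c d] by auto
      qed
      show "\<forall>p\<in>H. \<forall>q\<in>H. p \<noteq> q \<longrightarrow> {fst p<..<snd p} \<inter> {fst q<..<snd q} = {}"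
      proof (intro ballI impI)
        fix K K' assume "K \<in> H" "K' \<in> H" "K \<noteq> K'"
        then obtain I I' where I: "I \<in> F" "K \<in> G I" "I' \<in> F" "K' \<in> G I'" by (auto simp: H_def)
        show "{fst K<..<snd K} \<inter> {fst K'<..<snd K'} = {}"
        proof (cases "I = I'")
          case True
          then show ?thesis using G(3) I \<open>K \<noteq> K'\<close> by blast
        next
          case False
          have "\<not> (fst K < s \<and> s < snd K \<and> fst K' < s \<and> s < snd K')" for s
            using only[of I I' s] I False G(2)[of I K] G(2)[of I' K'] by auto
          then show ?thesis unfolding disjoint_iff greaterThanLessThan_iff by blast
        qed
      qed
      show "(\<Sum>p\<in>H. snd p - fst p) < \<delta>"
        using \<open>L - L' \<le> 2 * \<epsilon>\<close> \<epsilon> \<open>\<delta> > 0\<close> unfolding lenH by linarith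
    qed
    then have abs: "\<bar>\<Sum>p\<in>H. f (snd p) - f (fst p)\<bar> < \<eta>"
      using sum_abs[of "\<lambda>p. f (snd p) - f (fst p)" H] by linarith
    have Fq: "(\<Sum>p\<in>F. f (snd p) - f (fst p)) \<le> q * L"
      unfolding L_def sum_distrib_left by (rule sum_mono) (use F(2) in force)
    have F'p: "p * L' \<le> (\<Sum>p\<in>F'. f (snd p) - f (fst p))"
      unfolding L'_def sum_distrib_left by (rule sum_mono) (use F'(2) in \<open>force simp: R'_def\<close>)
    have "0 \<le> L - L'"
      unfolding lenH[symmetric] by (rule sum_nonneg) (use G(2) in \<open>fastforce simp: H_def\<close>)
    have "p * L - q * L < p * (L - L') + \<eta>"
      using abs sumH[of f] Fq F'p by (simp add: algebra_simps)
    also have "p * (L - L') \<le> \<bar>p\<bar> * (2 * \<epsilon>)"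
      by (rule mult_mono) (use \<open>L - L' \<le> 2 * \<epsilon>\<close> \<open>0 \<le> L - L'\<close> in auto)
    also have "\<bar>p\<bar> * (2 * \<epsilon>) \<le> (p - q) * m / 4"
    proof -
      have "8 * (\<bar>p\<bar> + 1) * \<epsilon> \<le> (p - q) * m"
        using \<epsilon>(4) by (simp add: pos_le_divide_eq mult.commute)
      then show ?thesis using \<epsilon>(1) by (simp add: algebra_simps)
    qed
    finally have "(p - q) * L < \<eta> * 2" by (simp add: \<eta>_def algebra_simps)
    moreover have "(p - q) * (m * 3 / 4) \<le> (p - q) * L"
      by (rule mult_left_mono) (use L \<epsilon> \<open>q < p\<close> in auto)
    moreover have "(p - q) * (m * 3 / 4) = 3 * \<eta>" by (simp add: \<eta>_def)
    ultimately show False using \<open>\<eta> > 0\<close> by linarith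
  qed
  then have "m = 0" using \<open>m \<ge> 0\<close> by force
  show ?thesis
    unfolding negligible_outer_le
  proof (intro allI impI)
    fix e :: real assume "e > 0"
    then show "\<exists>T. E \<subseteq> T \<and> T \<in> lmeasurable \<and> measure lebesgue T \<le> e"
      using approx[of e] \<open>m = 0\<close> by (auto intro: less_imp_le)
  qed
qed

text \<open>Disjoint intervals with slopes of modulus at least \<open>2 / e\<close> and total
  variation of the increments below 1 have total length at most \<open>e / 2\<close>. Absolute
  continuity controls the increments only for families shorter than \<delta> in total, hence the
  restriction to a short interval.\<close>

lemma infinite_slope_negligible_small:
  assumes ac: "abs_continuous_on_interval c d f"
  obtains \<delta> where "\<delta> > 0" "\<And>E s t. E \<subseteq> {s<..<t} \<Longrightarrow> c \<le> s \<Longrightarrow> t \<le> d \<Longrightarrow> t - s < \<delta> \<Longrightarrow>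
    (\<And>x P \<rho>. x \<in> E \<Longrightarrow> \<rho> > 0 \<Longrightarrow> \<exists>u v. u \<le> x \<and> x \<le> v \<and> u < v \<and> v - u < \<rho> \<and> P * (v - u) \<le> \<bar>f v - f u\<bar>) \<Longrightarrow> negligible E"
proof -
  obtain \<delta> where "\<delta> > 0" and \<delta>: "\<And>I. finite I \<Longrightarrow> (\<forall>p\<in>I. c \<le> fst p \<and> fst p \<le> snd p \<and> snd p \<le> d) \<Longrightarrow>
      (\<forall>p\<in>I. \<forall>q\<in>I. p \<noteq> q \<longrightarrow> {fst p<..<snd p} \<inter> {fst q<..<snd q} = {}) \<Longrightarrow>
      (\<Sum>p\<in>I. snd p - fst p) < \<delta> \<Longrightarrow> (\<Sum>p\<in>I. \<bar>f (snd p) - f (fst p)\<bar>) < 1"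
    by (rule abs_continuous_onE[OF ac zero_less_one]) blast
  have "negligible E" if E: "E \<subseteq> {s<..<t}" and st: "c \<le> s" "t \<le> d" "t - s < \<delta>"
    and steep: "\<And>x P \<rho>. x \<in> E \<Longrightarrow> \<rho> > 0 \<Longrightarrow> \<exists>u v. u \<le> x \<and> x \<le> v \<and> u < v \<and> v - u < \<rho> \<and> P * (v - u) \<le> \<bar>f v - f u\<bar>"
    for E s t
    unfolding negligible_outer_le
  proof (intro allI impI)
    fix e :: real assume "e > 0"
    obtain F Z where F: "finite F" "\<And>u v. (u, v) \<in> F \<Longrightarrow> u < v \<and> {u..v} \<subseteq> {s<..<t} \<and> 2 / e * (v - u) \<le> \<bar>f v - f u\<bar>"
      and disj: "\<And>p q. p \<in> F \<Longrightarrow> q \<in> F \<Longrightarrow> p \<noteq> q \<Longrightarrow> {fst p..snd p} \<inter> {fst q..snd q} = {}"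
      and Z: "Z \<in> lmeasurable" "E \<subseteq> Z" "measure lebesgue Z \<le> (\<Sum>p\<in>F. snd p - fst p) + e / 2"
      by (rule vitali_intervals[of E "\<lambda>u v. 2 / e * (v - u) \<le> \<bar>f v - f u\<bar>" "{s<..<t}" "e / 2"])
        (use E \<open>e > 0\<close> steep[of _ _ "2 / e"] in auto)
    have F2: "fst p < snd p" "s < fst p" "snd p < t" if "p \<in> F" for p
      using F(2)[of "fst p" "snd p"] that Icc_subset_IooD[of "fst p" "snd p" s t] by auto
    have "(\<Sum>p\<in>F. \<bar>f (snd p) - f (fst p)\<bar>) < 1 \<or> F = {}"
    proof (intro disjCI \<delta> F(1))
      assume "F \<noteq> {}"
      then have "s < t" using F2 by force
      have "(\<Sum>p\<in>F. snd p - fst p) \<le> measure lebesgue {s<..<t}"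
        by (rule sum_lengths_le_measure[OF F(1) _ disj]) (use F2 in fastforce)+
      then show "(\<Sum>p\<in>F. snd p - fst p) < \<delta>" using st \<open>s < t\<close> by simp
      show "\<forall>p\<in>F. c \<le> fst p \<and> fst p \<le> snd p \<and> snd p \<le> d" using F2 st by fastforce
      show "\<forall>p\<in>F. \<forall>q\<in>F. p \<noteq> q \<longrightarrow> {fst p<..<snd p} \<inter> {fst q<..<snd q} = {}"
      proof (intro ballI impI)
        fix p q assume "p \<in> F" "q \<in> F" "p \<noteq> q"
        moreover have "{fst p<..<snd p} \<subseteq> {fst p..snd p}" "{fst q<..<snd q} \<subseteq> {fst q..snd q}" by auto
        ultimately show "{fst p<..<snd p} \<inter> {fst q<..<snd q} = {}" using disj by blast
      qed
    qed
    moreover have "2 / e * (\<Sum>p\<in>F. snd p - fst p) \<le> (\<Sum>p\<in>F. \<bar>f (snd p) - f (fst p)\<bar>)"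
      unfolding sum_distrib_left by (rule sum_mono) (use F(2) in force)
    ultimately have "2 / e * (\<Sum>p\<in>F. snd p - fst p) \<le> 1" by force
    then have "(\<Sum>p\<in>F. snd p - fst p) \<le> e / 2" using \<open>e > 0\<close> by (simp add: field_simps)
    then show "\<exists>T. E \<subseteq> T \<and> T \<in> lmeasurable \<and> measure lebesgue T \<le> e"
      using Z by (intro exI[of _ Z]) auto
  qed
  then show thesis using that[OF \<open>\<delta> > 0\<close>] by blast
qed

lemma infinite_slope_negligible:
  assumes ac: "abs_continuous_on_interval c d f" and E: "E \<subseteq> {c<..<d}"
    and steep: "\<And>x P \<rho>. x \<in> E \<Longrightarrow> \<rho> > 0 \<Longrightarrow> \<exists>u v. u \<le> x \<and> x \<le> v \<and> u < v \<and> v - u < \<rho> \<and> P * (v - u) \<le> \<bar>f v - f u\<bar>"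
  shows "negligible E"
proof -
  obtain \<delta> where "\<delta> > 0" and \<delta>: "\<And>E s t. E \<subseteq> {s<..<t} \<Longrightarrow> c \<le> s \<Longrightarrow> t \<le> d \<Longrightarrow> t - s < \<delta> \<Longrightarrow>
    (\<And>x P \<rho>. x \<in> E \<Longrightarrow> \<rho> > 0 \<Longrightarrow> \<exists>u v. u \<le> x \<and> x \<le> v \<and> u < v \<and> v - u < \<rho> \<and> P * (v - u) \<le> \<bar>f v - f u\<bar>) \<Longrightarrow> negligible E"
    using infinite_slope_negligible_small[OF ac] by metis
  define Q where "Q = {(s, t) \<in> \<rat> \<times> \<rat>. c \<le> s \<and> t \<le> d \<and> t - s < \<delta>}"
  have "countable Q"
    by (rule countable_subset[of _ "\<rat> \<times> \<rat>"]) (auto simp: Q_def intro: countable_rat countable_SIGMA)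
  have "E \<subseteq> (\<Union>(s, t)\<in>Q. E \<inter> {s<..<t})"
  proof
    fix x assume "x \<in> E"
    then have "c < x" "x < d" using E by auto
    obtain s where s: "s \<in> \<rat>" "max c (x - \<delta> / 2) < s" "s < x"
      using Rats_dense_in_real[of "max c (x - \<delta> / 2)" x] \<open>c < x\<close> \<open>\<delta> > 0\<close> by auto
    obtain t where t: "t \<in> \<rat>" "x < t" "t < min d (x + \<delta> / 2)"
      using Rats_dense_in_real[of x "min d (x + \<delta> / 2)"] \<open>x < d\<close> \<open>\<delta> > 0\<close> by auto
    have "(s, t) \<in> Q" using s t by (auto simp: Q_def)
    then show "x \<in> (\<Union>(s, t)\<in>Q. E \<inter> {s<..<t})" using s t \<open>x \<in> E\<close> by force
  qed
  moreover have "negligible (\<Union>(s, t)\<in>Q. E \<inter> {s<..<t})"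
  proof (rule negligible_countable_Union)
    show "countable ((\<lambda>(s, t). E \<inter> {s<..<t}) ` Q)" using \<open>countable Q\<close> by blast
    fix X assume "X \<in> (\<lambda>(s, t). E \<inter> {s<..<t}) ` Q"
    then obtain s t where "X = E \<inter> {s<..<t}" "c \<le> s" "t \<le> d" "t - s < \<delta>" by (auto simp: Q_def)
    then show "negligible X" using steep by (intro \<delta>[of X s t]) auto
  qed
  ultimately show ?thesis by (rule negligible_subset[rotated])
qed

text \<open>The difference quotients at \<open>x\<close> are either unbounded near \<open>x\<close>,
  or have finite lower and upper limits that differ and can be separated by two rational numbers.
  Rational \<open>q\<close> and \<open>p\<close> leave only countably many exceptional sets to be
  shown negligible.\<close>

lemma nondifferentiable_cases:
  fixes f :: "real \<Rightarrow> real"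
  assumes nd: "\<not> f field_differentiable at x"
  shows "(\<forall>P. \<forall>\<rho>>0. \<exists>u v. u \<le> x \<and> x \<le> v \<and> u < v \<and> v - u < \<rho> \<and> P * (v - u) \<le> \<bar>f v - f u\<bar>) \<or>
    (\<exists>q\<in>\<rat>. \<exists>p\<in>\<rat>. q < p \<and> (\<forall>\<rho>>0. \<exists>u v. u \<le> x \<and> x \<le> v \<and> u < v \<and> v - u < \<rho> \<and> f v - f u \<le> q * (v - u)) \<and>
      (\<forall>\<rho>>0. \<exists>u v. u \<le> x \<and> x \<le> v \<and> u < v \<and> v - u < \<rho> \<and> p * (v - u) \<le> f v - f u))"
proof (rule ccontr)
  assume neg: "\<not> ?thesis"
  define s where "s y = (f y - f x) / (y - x)" for y
  have slope: "\<exists>u v. u \<le> x \<and> x \<le> v \<and> u < v \<and> v - u = \<bar>y - x\<bar> \<and> f v - f u = s y * (v - u)" if "y \<noteq> x" for y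
  proof (cases "y < x")
    case True
    then show ?thesis by (intro exI[of _ y] exI[of _ x]) (simp add: s_def field_simps)
  next
    case False
    then show ?thesis using that by (intro exI[of _ x] exI[of _ y]) (simp add: s_def field_simps)
  qed
  have freq: "\<forall>\<rho>>0. \<exists>u v. u \<le> x \<and> x \<le> v \<and> u < v \<and> v - u < \<rho> \<and> R (f v - f u) (v - u)"
    if fr: "\<exists>\<^sub>F y in at x. Q (s y)" and R: "\<And>a w. Q a \<Longrightarrow> w > 0 \<Longrightarrow> R (a * w) w" for Q and R :: "real \<Rightarrow> real \<Rightarrow> bool"
  proof (intro allI impI)
    fix \<rho> :: real assume "\<rho> > 0"
    obtain y where y: "Q (s y)" "y \<noteq> x" "\<bar>y - x\<bar> < \<rho>"
      using fr \<open>\<rho> > 0\<close> unfolding frequently_def eventually_at by (auto simp: dist_real_def)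
    obtain u v where "u \<le> x" "x \<le> v" "u < v" "v - u = \<bar>y - x\<bar>" "f v - f u = s y * (v - u)"
      using slope[OF y(2)] by blast
    then show "\<exists>u v. u \<le> x \<and> x \<le> v \<and> u < v \<and> v - u < \<rho> \<and> R (f v - f u) (v - u)"
      using y R by (intro exI[of _ u] exI[of _ v]) auto
  qed
  obtain P where P: "\<forall>\<^sub>F y in at x. \<bar>s y\<bar> < P"
  proof -
    obtain P where "\<not> (\<forall>\<rho>>0. \<exists>u v. u \<le> x \<and> x \<le> v \<and> u < v \<and> v - u < \<rho> \<and> P * (v - u) \<le> \<bar>f v - f u\<bar>)"
      using neg by blast
    then have "\<not> (\<exists>\<^sub>F y in at x. \<bar>s y\<bar> \<ge> P)"
      using freq[of "\<lambda>a. \<bar>a\<bar> \<ge> P" "\<lambda>a w. P * w \<le> \<bar>a\<bar>"] by (fastforce simp: abs_mult)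
    then show thesis using that by (simp add: frequently_def not_le)
  qed
  define l L where "l = Liminf (at x) (\<lambda>y. ereal (s y))" and "L = Limsup (at x) (\<lambda>y. ereal (s y))"
  have "l \<le> L" unfolding l_def L_def by (rule Liminf_le_Limsup) simp
  have "L \<le> ereal P" unfolding L_def
    by (rule Limsup_bounded) (use P in \<open>auto elim!: eventually_mono\<close>)
  have "ereal (- P) \<le> l" unfolding l_def
    by (rule Liminf_bounded) (use P in \<open>auto elim!: eventually_mono\<close>)
  show False
  proof (cases "l = L")
    case True
    then have "\<bar>l\<bar> \<noteq> \<infinity>" using \<open>L \<le> ereal P\<close> \<open>ereal (- P) \<le> l\<close> by auto
    then obtain D where D: "l = ereal D" by (cases l) auto
    have "((\<lambda>y. ereal (s y)) \<longlongrightarrow> ereal D) (at x)"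
      using True D by (intro Liminf_eq_Limsup) (auto simp: l_def L_def)
    then have "(s \<longlongrightarrow> D) (at x)" by simp
    then have "(f has_field_derivative D) (at x)"
      unfolding s_def has_field_derivative_iff .
    then show False using nd by (auto simp: field_differentiable_def)
  next
    case False
    then have "l < L" using \<open>l \<le> L\<close> by simp
    then obtain a where a: "l < ereal a" "ereal a < L" using ereal_dense2 by blast
    obtain b where b: "ereal a < ereal b" "ereal b < L" using ereal_dense2[OF a(2)] by blast
    obtain q where q: "q \<in> \<rat>" "a < q" "q < b" using Rats_dense_in_real b(1) by auto
    obtain p where p: "p \<in> \<rat>" "q < p" "p < b" using Rats_dense_in_real q(3) by auto
    have "\<exists>\<^sub>F y in at x. s y \<le> q"
    proof (rule ccontr)
      assume "\<not> ?thesis"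
      then have "ereal q \<le> l" unfolding l_def frequently_def
        by (intro Liminf_bounded) (auto elim!: eventually_mono)
      then show False using a(1) q(2) by (meson ereal_less_eq(3) less_le_not_le order_less_le_trans order_less_imp_le order_trans)
    qed
    from freq[OF this, of "\<lambda>a w. a \<le> q * w"]
    have 1: "\<forall>\<rho>>0. \<exists>u v. u \<le> x \<and> x \<le> v \<and> u < v \<and> v - u < \<rho> \<and> f v - f u \<le> q * (v - u)" by simp
    have "\<exists>\<^sub>F y in at x. s y \<ge> p"
    proof (rule ccontr)
      assume "\<not> ?thesis"
      then have "L \<le> ereal p" unfolding L_def frequently_def
        by (intro Limsup_bounded) (auto elim!: eventually_mono)
      then have "ereal b < ereal p" using b(2) by (rule order_less_le_trans[rotated])
      then show False using p(3) by simp
    qed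
    from freq[OF this, of "\<lambda>a w. p * w \<le> a"]
    have "\<forall>\<rho>>0. \<exists>u v. u \<le> x \<and> x \<le> v \<and> u < v \<and> v - u < \<rho> \<and> p * (v - u) \<le> f v - f u" by simp
    then show False using neg 1 p(1,2) q(1) by blast
  qed
qed

lemma abs_continuous_nondifferentiable_negligible:
  assumes ac: "abs_continuous_on_interval c d f"
  shows "negligible {x \<in> {c<..<d}. \<not> f field_differentiable at x}"
proof -
  define E where "E = {x \<in> {c<..<d}. \<forall>P. \<forall>\<rho>>0. \<exists>u v. u \<le> x \<and> x \<le> v \<and> u < v \<and> v - u < \<rho> \<and> P * (v - u) \<le> \<bar>f v - f u\<bar>}"
  define E2 where "E2 q p = {x \<in> {c<..<d}. (\<forall>\<rho>>0. \<exists>u v. u \<le> x \<and> x \<le> v \<and> u < v \<and> v - u < \<rho> \<and> f v - f u \<le> q * (v - u)) \<and>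
      (\<forall>\<rho>>0. \<exists>u v. u \<le> x \<and> x \<le> v \<and> u < v \<and> v - u < \<rho> \<and> p * (v - u) \<le> f v - f u)}" for q p :: real
  define Q :: "(real \<times> real) set" where "Q = {(q, p) \<in> \<rat> \<times> \<rat>. q < p}"
  have "countable Q"
    by (rule countable_subset[of _ "\<rat> \<times> \<rat>"]) (auto simp: Q_def intro: countable_rat countable_SIGMA)
  have "negligible E"
    by (rule infinite_slope_negligible[OF ac]) (auto simp: E_def)
  moreover have "negligible (\<Union>(q, p)\<in>Q. E2 q p)"
  proof (rule negligible_countable_Union)
    show "countable ((\<lambda>(q, p). E2 q p) ` Q)" using \<open>countable Q\<close> by blast
    fix X assume "X \<in> (\<lambda>(q, p). E2 q p) ` Q"
    then obtain q p where X: "X = E2 q p" and "q < p" by (auto simp: Q_def)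
    show "negligible X"
      unfolding X by (rule two_slopes_negligible[OF ac \<open>q < p\<close>]) (auto simp: E2_def)
  qed
  ultimately have "negligible (E \<union> (\<Union>(q, p)\<in>Q. E2 q p))" by (rule negligible_Un)
  moreover have "{x \<in> {c<..<d}. \<not> f field_differentiable at x} \<subseteq> E \<union> (\<Union>(q, p)\<in>Q. E2 q p)"
  proof
    fix x assume x: "x \<in> {x \<in> {c<..<d}. \<not> f field_differentiable at x}"
    with nondifferentiable_cases[of f x] have "x \<in> E \<or> (\<exists>q\<in>\<rat>. \<exists>p\<in>\<rat>. q < p \<and> x \<in> E2 q p)"
      by (simp add: E_def E2_def) 
    then show "x \<in> E \<union> (\<Union>(q, p)\<in>Q. E2 q p)" by (auto simp: Q_def)
  qed
  ultimately show ?thesis by (rule negligible_subset)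
qed

text \<open>The value of \<open>deriv f\<close> at a point where \<open>f\<close> is not differentiable is unspecified and may
  well satisfy the bound; this is why such points must be known to be negligible.\<close>

lemma abs_continuous_increment_le:
  assumes ac: "abs_continuous_on_interval c d f" and "c \<le> d"
    and bound: "negligible {x. \<not> \<bar>deriv f x\<bar> \<le> B}"
  shows "\<bar>f d - f c\<bar> \<le> B * (d - c)"
proof -
  have le: "\<sigma> * (f d - f c) \<le> B * (d - c)" if \<sigma>: "\<bar>\<sigma>\<bar> = 1" for \<sigma> :: real
  proof (cases "c < d")
    case True
    define E where "E = {x \<in> {c<..<d}. f field_differentiable at x \<and> \<bar>deriv f x\<bar> \<le> B}"
    have neg: "negligible ({c<..<d} - E)"
      by (rule negligible_subset[OF negligible_Un[OF abs_continuous_nondifferentiable_negligible[OF ac] bound]])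
        (auto simp: E_def)
    \<comment> \<open>A Vitali family of intervals of slope at most \<open>B + \<eta>\<close> leaves
      gaps of total length below \<delta>, and these contribute less than \<eta> to the
      increment.\<close>
    have step: "\<sigma> * (f d - f c) \<le> \<eta> + (B + \<eta>) * (d - c)" if "\<eta> > 0" for \<eta> :: real
    proof -
      obtain \<delta> where "\<delta> > 0" and \<delta>: "\<And>I. finite I \<Longrightarrow> (\<forall>p\<in>I. c \<le> fst p \<and> fst p \<le> snd p \<and> snd p \<le> d) \<Longrightarrow>
          (\<forall>p\<in>I. \<forall>q\<in>I. p \<noteq> q \<longrightarrow> {fst p<..<snd p} \<inter> {fst q<..<snd q} = {}) \<Longrightarrow>
          (\<Sum>p\<in>I. snd p - fst p) < \<delta> \<Longrightarrow> (\<Sum>p\<in>I. \<bar>f (snd p) - f (fst p)\<bar>) < \<eta>"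
        by (rule abs_continuous_onE[OF ac \<open>\<eta> > 0\<close>]) blast
      have small: "\<exists>u v. u \<le> t \<and> t \<le> v \<and> u < v \<and> v - u < \<rho> \<and> \<sigma> * (f v - f u) \<le> (B + \<eta>) * (v - u)"
        if t: "t \<in> E" and "\<rho> > 0" for t \<rho>
      proof -
        have "(f has_field_derivative deriv f t) (at t)"
          using t DERIV_deriv_iff_field_differentiable by (auto simp: E_def)
        then have "((\<lambda>y. \<sigma> * ((f y - f t) / (y - t))) \<longlongrightarrow> \<sigma> * deriv f t) (at t)"
          by (intro tendsto_intros) (simp add: has_field_derivative_iff)
        moreover have "\<sigma> * deriv f t < B + \<eta>"
        proof -
          have "\<sigma> * deriv f t \<le> \<bar>\<sigma> * deriv f t\<bar>" by simp
          also have "\<dots> \<le> B" using t \<sigma> by (simp add: abs_mult E_def)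
          finally show ?thesis using \<open>\<eta> > 0\<close> by simp
        qed
        ultimately have "\<forall>\<^sub>F y in at t. \<sigma> * ((f y - f t) / (y - t)) < B + \<eta>"
          by (rule order_tendstoD)
        then obtain r where "r > 0" and r: "\<And>y. y \<noteq> t \<Longrightarrow> \<bar>y - t\<bar> < r \<Longrightarrow> \<sigma> * ((f y - f t) / (y - t)) < B + \<eta>"
          by (auto simp: eventually_at dist_real_def)
        define y where "y = t + min r \<rho> / 2"
        have y: "t < y" "y - t < \<rho>" "\<bar>y - t\<bar> < r" using \<open>r > 0\<close> \<open>\<rho> > 0\<close> by (auto simp: y_def)
        then have "\<sigma> * (f y - f t) \<le> (B + \<eta>) * (y - t)"
          using r[of y] by (simp add: field_simps)
        then show ?thesis using y by (intro exI[of _ t] exI[of _ y]) auto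
      qed
      obtain F Z where F: "finite F" "\<And>u v. (u, v) \<in> F \<Longrightarrow> u < v \<and> {u..v} \<subseteq> {c<..<d} \<and> \<sigma> * (f v - f u) \<le> (B + \<eta>) * (v - u)"
        and disj: "\<And>p q. p \<in> F \<Longrightarrow> q \<in> F \<Longrightarrow> p \<noteq> q \<Longrightarrow> {fst p..snd p} \<inter> {fst q..snd q} = {}"
        and Z: "Z \<in> lmeasurable" "E \<subseteq> Z" "measure lebesgue Z \<le> (\<Sum>p\<in>F. snd p - fst p) + \<delta> / 2"
        by (rule vitali_intervals[of E "\<lambda>u v. \<sigma> * (f v - f u) \<le> (B + \<eta>) * (v - u)" "{c<..<d}" "\<delta> / 2"])
          (use small \<open>\<delta> > 0\<close> in \<open>auto simp: E_def\<close>)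
      define L where "L = (\<Sum>p\<in>F. snd p - fst p)"
      have F2: "fst p < snd p" "c < fst p" "snd p < d" if "p \<in> F" for p
        using F(2)[of "fst p" "snd p"] that Icc_subset_IooD[of "fst p" "snd p" c d] by auto
      have "d - c \<le> L + \<delta> / 2"
      proof -
        have "measure lebesgue {c<..<d} \<le> measure lebesgue (Z \<union> ({c<..<d} - E))"
          by (rule measure_mono_fmeasurable) (use Z neg in \<open>auto simp: negligible_imp_measurable intro!: fmeasurable.Un\<close>)
        also have "\<dots> = measure lebesgue Z"
          using Z neg by (auto simp: fmeasurableD negligible_iff_null_sets intro!: measure_Un_null_set)
        finally show ?thesis using Z True by (simp add: L_def)
      qed
      have "L \<le> measure lebesgue {c<..<d}"
        unfolding L_def by (rule sum_lengths_le_measure[OF F(1) _ disj]) (use F2 in fastforce)+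
      then have "L \<le> d - c" using True by simp
      have "\<exists>H. finite H \<and> (\<forall>p\<in>H. c \<le> fst p \<and> fst p \<le> snd p \<and> snd p \<le> d) \<and>
          (\<forall>p\<in>H. \<forall>q\<in>H. p \<noteq> q \<longrightarrow> {fst p<..<snd p} \<inter> {fst q<..<snd q} = {}) \<and>
          (\<forall>f :: real \<Rightarrow> real. (\<Sum>p\<in>H. f (snd p) - f (fst p)) = f d - f c - (\<Sum>p\<in>F. f (snd p) - f (fst p)))"
        by (rule interval_gaps[OF F(1) _ disj \<open>c \<le> d\<close>]) (use F2 in \<open>force intro: less_imp_le\<close>)+
      then obtain H where H: "finite H" "\<forall>p\<in>H. c \<le> fst p \<and> fst p \<le> snd p \<and> snd p \<le> d"
          "\<forall>p\<in>H. \<forall>q\<in>H. p \<noteq> q \<longrightarrow> {fst p<..<snd p} \<inter> {fst q<..<snd q} = {}"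
          "\<forall>f :: real \<Rightarrow> real. (\<Sum>p\<in>H. f (snd p) - f (fst p)) = f d - f c - (\<Sum>p\<in>F. f (snd p) - f (fst p))"
        by (elim exE conjE)
      have "(\<Sum>p\<in>H. snd p - fst p) = d - c - L"
        using H(4)[rule_format, of "\<lambda>x. x"] by (simp add: L_def)
      then have "(\<Sum>p\<in>H. \<bar>f (snd p) - f (fst p)\<bar>) < \<eta>"
        using \<open>d - c \<le> L + \<delta> / 2\<close> \<open>\<delta> > 0\<close> by (intro \<delta> H) linarith
      moreover have "\<sigma> * (\<Sum>p\<in>H. f (snd p) - f (fst p)) \<le> (\<Sum>p\<in>H. \<bar>f (snd p) - f (fst p)\<bar>)"
      proof -
        have "\<sigma> * (\<Sum>p\<in>H. f (snd p) - f (fst p)) \<le> \<bar>\<sigma> * (\<Sum>p\<in>H. f (snd p) - f (fst p))\<bar>" by simp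
        also have "\<dots> \<le> (\<Sum>p\<in>H. \<bar>f (snd p) - f (fst p)\<bar>)" using \<sigma> by (simp add: abs_mult sum_abs)
        finally show ?thesis .
      qed
      moreover have "\<sigma> * (\<Sum>p\<in>F. f (snd p) - f (fst p)) \<le> (B + \<eta>) * L"
        unfolding L_def sum_distrib_left by (rule sum_mono) (use F(2) in force)
      moreover have "(B + \<eta>) * L \<le> (B + \<eta>) * (d - c)"
      proof (rule mult_left_mono[OF \<open>L \<le> d - c\<close>])
        \<comment> \<open>A point of \<open>E\<close> witnesses \<open>0 \<le> B\<close>, without
          which the product would not be monotone in the length.\<close>
        have "E \<noteq> {}"
        proof
          assume "E = {}"
          then have "negligible {c<..<d}" using neg by simp
          then have "measure lebesgue {c<..<d} = 0" by (rule negligible_imp_measure0)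
          then show False using True by simp
        qed
        then have "0 \<le> B" by (auto simp: E_def)
        then show "0 \<le> B + \<eta>" using \<open>\<eta> > 0\<close> by simp
      qed
      moreover have "\<sigma> * (f d - f c) = \<sigma> * (\<Sum>p\<in>H. f (snd p) - f (fst p)) + \<sigma> * (\<Sum>p\<in>F. f (snd p) - f (fst p))"
        unfolding distrib_left[symmetric] H(4)[rule_format] by simp
      ultimately show ?thesis by linarith
    qed
    show ?thesis
    proof (rule field_le_epsilon)
      fix e :: real assume "e > 0"
      have "0 < 1 + (d - c)" using True by simp
      define w where "w = e / (1 + (d - c))"
      have w: "w > 0" "w * (1 + (d - c)) = e"
        using \<open>e > 0\<close> \<open>0 < 1 + (d - c)\<close> by (auto simp: w_def)
      show "\<sigma> * (f d - f c) \<le> B * (d - c) + e"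
        using step[OF w(1)] unfolding w(2)[symmetric] by (simp add: algebra_simps)
    qed
  next
    case False
    then show ?thesis using \<open>c \<le> d\<close> by simp
  qed
  show ?thesis using le[of 1] le[of "-1"] by (simp add: abs_le_iff)
qed

section \<open>Comparison with periodic half-waves\<close>

lemma antiperiodic_shift:
  fixes f :: "real \<Rightarrow> real"
  assumes anti: "\<And>t. f (t + T) = - f t"
  shows "\<exists>\<sigma>\<in>{1, -1}. \<forall>v. f (v + of_int k * T) = \<sigma> * f v"
proof (induction k rule: int_induct[where k = 0])
  case base
  then show ?case by simp
next
  case (step1 i)
  then obtain \<sigma> where \<sigma>: "\<sigma> \<in> {1, -1}" "\<forall>v. f (v + of_int i * T) = \<sigma> * f v" by blast
  have "f (v + of_int (i + 1) * T) = - \<sigma> * f v" for v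
    using \<sigma>(2)[rule_format, of v] anti[of "v + of_int i * T"] by (simp add: algebra_simps)
  then show ?case using \<sigma>(1) by (intro bexI[of _ "- \<sigma>"]) auto
next
  case (step2 i)
  then obtain \<sigma> where \<sigma>: "\<sigma> \<in> {1, -1}" "\<forall>v. f (v + of_int i * T) = \<sigma> * f v" by blast
  have "f (v + of_int (i - 1) * T) = - \<sigma> * f v" for v
    using \<sigma>(2)[rule_format, of v] anti[of "v + of_int (i - 1) * T"] by (simp add: algebra_simps)
  then show ?case using \<sigma>(1) by (intro bexI[of _ "- \<sigma>"]) auto
qed

text \<open>A single sign and a single shift serve for all \<open>v\<close>, so that continuity and
  derivatives can be transported from \<open>u\<close> to \<open>t\<close>, not only the
  value.\<close>

lemma antiperiodic_reduce:
  fixes f :: "real \<Rightarrow> real"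
  assumes anti: "\<And>t. f (t + T) = - f t" and "0 < T"
  obtains u \<sigma> k where "\<sigma> \<in> {1, -1}" "a \<le> u" "u < a + T" "\<And>v. f (v + of_int k * T) = \<sigma> * f v"
    "t = u + of_int k * T"
proof -
  define k where "k = \<lfloor>(t - a) / T\<rfloor>"
  define u where "u = t - of_int k * T"
  have "of_int k \<le> (t - a) / T" "(t - a) / T < of_int k + 1" unfolding k_def by linarith+
  then have u: "a \<le> u" "u < a + T" using \<open>0 < T\<close> by (simp_all add: u_def field_simps)
  obtain \<sigma> where \<sigma>: "\<sigma> \<in> {1, -1}" "\<forall>v. f (v + of_int k * T) = \<sigma> * f v"
    using antiperiodic_shift[of f T k, OF anti] by blast
  show thesis
    by (rule that[OF \<sigma>(1) u \<sigma>(2)[rule_format]]) (simp add: u_def)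
qed

text \<open>\<open>C\<close> is the centre of the positive half-wave, \<open>w\<close> its half-width, \<open>q\<close> the length of its rising
  part, \<open>M\<close> its height and \<open>T\<close> half the period. There is a plateau at the top if \<open>q < w\<close> and a plateau at
  zero if \<open>2 * w < T\<close>.\<close>

definition hump :: "(real \<Rightarrow> real) \<Rightarrow> real \<Rightarrow> real \<Rightarrow> real \<Rightarrow> real \<Rightarrow> real \<Rightarrow> bool" where
  "hump \<phi> C w q M T \<longleftrightarrow>
     continuous_on UNIV \<phi> \<and> (\<forall>t. \<phi> (t + T) = - \<phi> t) \<and> (\<forall>t. \<phi> (2 * C - t) = \<phi> t) \<and>
     0 < q \<and> q \<le> w \<and> 2 * w \<le> T \<and> \<phi> (C - w) = 0 \<and> strict_mono_on {C - w..C - w + q} \<phi> \<and>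
     (\<forall>t\<in>{C - w + q..C}. \<phi> t = M) \<and> (\<forall>t\<in>{C + w..C + T / 2}. \<phi> t = 0)"

text \<open>From a common value on the rising branch \<open>{\<alpha>..\<beta>}\<close>, neither \<open>x\<close> nor \<open>- x\<close> falls faster than \<open>\<phi>\<close>,
  in either direction of time. Unlike a comparison of derivatives, this makes sense for \<open>x\<close> that is
  merely Lipschitz.\<close>

definition dominated :: "(real \<Rightarrow> real) \<Rightarrow> (real \<Rightarrow> real) \<Rightarrow> real \<Rightarrow> real \<Rightarrow> bool" where
  "dominated x \<phi> \<alpha> \<beta> \<longleftrightarrow>
     (\<forall>\<tau> \<xi> s. \<forall>\<sigma>\<in>{1, -1}. \<forall>\<delta>\<in>{1, -1}.
        \<alpha> \<le> \<xi> - s \<longrightarrow> 0 \<le> s \<longrightarrow> \<xi> \<le> \<beta> \<longrightarrow> \<phi> \<xi> \<le> \<sigma> * x \<tau> \<longrightarrow> \<phi> (\<xi> - s) \<le> \<sigma> * x (\<tau> + \<delta> * s))"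

lemma dominatedD:
  assumes "dominated x \<phi> \<alpha> \<beta>" "\<sigma> \<in> {1, -1}" "\<delta> \<in> {1, -1}" "\<alpha> \<le> \<xi> - s" "0 \<le> s" "\<xi> \<le> \<beta>" "\<phi> \<xi> \<le> \<sigma> * x \<tau>"
  shows "\<phi> (\<xi> - s) \<le> \<sigma> * x (\<tau> + \<delta> * s)"
  using assms unfolding dominated_def by blast

lemma dominated_subset:
  assumes "dominated x \<phi> \<alpha> \<beta>" "\<alpha> \<le> \<alpha>'" "\<beta>' \<le> \<beta>"
  shows "dominated x \<phi> \<alpha>' \<beta>'"
  using assms unfolding dominated_def by (meson order_trans)

lemma dominated_transform:
  assumes d: "dominated x \<phi> \<alpha> \<beta>" and "\<sigma>' \<in> {1, -1}" "\<delta>' \<in> {1, -1}"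
  shows "dominated (\<lambda>t. \<sigma>' * x (\<delta>' * t)) \<phi> \<alpha> \<beta>"
  unfolding dominated_def
proof (intro allI ballI impI)
  fix \<tau> \<xi> s \<sigma> \<delta> :: real
  assume *: "\<sigma> \<in> {1, -1}" "\<delta> \<in> {1, -1}" "\<alpha> \<le> \<xi> - s" "0 \<le> s" "\<xi> \<le> \<beta>" "\<phi> \<xi> \<le> \<sigma> * (\<sigma>' * x (\<delta>' * \<tau>))"
  have "\<phi> (\<xi> - s) \<le> (\<sigma> * \<sigma>') * x (\<delta>' * \<tau> + (\<delta>' * \<delta>) * s)"
    by (rule dominatedD[OF d _ _ *(3-5)]) (use * assms(2,3) in auto)
  then show "\<phi> (\<xi> - s) \<le> \<sigma> * (\<sigma>' * x (\<delta>' * (\<tau> + \<delta> * s)))"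
    by (simp add: algebra_simps)
qed

section \<open>Shape of a half-wave\<close>

context
  fixes \<phi> :: "real \<Rightarrow> real" and C w q M T :: real
  assumes h: "hump \<phi> C w q M T"
begin

lemma hump_continuous: "continuous_on A \<phi>"
  using h unfolding hump_def by (blast intro: continuous_on_subset)

lemma hump_antiperiodic: "\<phi> (t + T) = - \<phi> t" "\<phi> (t - T) = - \<phi> t"
  using h unfolding hump_def by (simp, metis add.inverse_inverse diff_add_cancel)

lemma hump_reflect: "\<phi> (2 * C - t) = \<phi> t"
  using h unfolding hump_def by simp

lemma hump_dims: "0 < q" "q \<le> w" "2 * w \<le> T" "0 < w" "0 < T"
  using h unfolding hump_def by auto

lemma hump_left: "\<phi> (C - w) = 0"
  using h unfolding hump_def by simp

lemma hump_plateau: "C - w + q \<le> t \<Longrightarrow> t \<le> C \<Longrightarrow> \<phi> t = M"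
  using h unfolding hump_def by simp

lemma hump_gap: "C + w \<le> t \<Longrightarrow> t \<le> C + T / 2 \<Longrightarrow> \<phi> t = 0"
  using h unfolding hump_def by simp

lemma hump_less: "C - w \<le> s \<Longrightarrow> s < t \<Longrightarrow> t \<le> C - w + q \<Longrightarrow> \<phi> s < \<phi> t"
  using h unfolding hump_def strict_mono_on_def by simp

lemma hump_max: "\<phi> (C - w + q) = M" "0 < M"
  using hump_plateau[of "C - w + q"] hump_less[of "C - w" "C - w + q"] hump_left hump_dims by auto

lemma hump_le_left: "C - w \<le> t \<Longrightarrow> t \<le> C \<Longrightarrow> \<phi> t \<le> M"
  using hump_less[of t "C - w + q"] hump_plateau[of t] hump_max by (cases "t < C - w + q") auto

lemma hump_pos: 
  assumes "C - w < t" "t < C + w" shows "0 < \<phi> t"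
proof -
  have *: "0 < \<phi> t" if "C - w < t" "t \<le> C" for t
    using hump_less[of "C - w" t] hump_plateau[of t] hump_left hump_max that by (cases "t < C - w + q") auto
  show ?thesis
    using *[of t] *[of "2 * C - t"] hump_reflect[of t] assms by (cases "t \<le> C") auto
qed

lemma hump_right: "\<phi> (C + w) = 0"
  using hump_reflect[of "C - w"] hump_left by (simp add: algebra_simps)

lemma hump_nonneg: "C - w \<le> t \<Longrightarrow> t \<le> C + w \<Longrightarrow> 0 \<le> \<phi> t"
  using hump_pos[of t] hump_left hump_right by (cases "t = C - w \<or> t = C + w") auto

lemma hump_reduce:
  obtains u \<sigma> where "\<sigma> \<in> {1, -1}" "a \<le> u" "u < a + T" "\<And>v. \<phi> (t + v) = \<sigma> * \<phi> (u + v)"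
proof -
  obtain u \<sigma> k where *: "\<sigma> \<in> {1, -1}" "a \<le> u" "u < a + T"
    and \<sigma>: "\<And>v. \<phi> (v + of_int k * T) = \<sigma> * \<phi> v" and t: "t = u + of_int k * T"
    by (rule antiperiodic_reduce[of \<phi> T a t, OF hump_antiperiodic(1) hump_dims(5)]) (rule that)
  have "\<phi> (t + v) = \<sigma> * \<phi> (u + v)" for v
    using \<sigma>[of "u + v"] by (simp add: t add_ac)
  with * show thesis by (rule that)
qed

lemma hump_abs_le: "\<bar>\<phi> t\<bar> \<le> M"
proof -
  obtain u \<sigma> where u: "\<sigma> \<in> {1, -1}" "C - T / 2 \<le> u" "u < C - T / 2 + T" "\<And>v. \<phi> (t + v) = \<sigma> * \<phi> (u + v)"
    by (rule hump_reduce[of "C - T / 2" t]) (rule that)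
  have *: "0 \<le> \<phi> u \<and> \<phi> u \<le> M" if "u \<le> C" "C - T / 2 \<le> u" for u
  proof (cases "C - w \<le> u")
    case True
    then show ?thesis using hump_nonneg[of u] hump_le_left[of u] that hump_dims by auto
  next
    case False
    then show ?thesis using hump_gap[of "2 * C - u"] hump_reflect[of u] that hump_max by auto
  qed
  have "0 \<le> \<phi> u \<and> \<phi> u \<le> M"
    using *[of u] *[of "2 * C - u"] hump_reflect[of u] u(2,3) by (cases "u \<le> C") auto
  then show ?thesis using u(1) u(4)[of 0] by (auto simp: abs_mult)
qed

lemma hump_scale:
  assumes "c > 0" shows "hump (\<lambda>t. c * \<phi> t) C w q (c * M) T"
proof -
  have "continuous_on UNIV (\<lambda>t. c * \<phi> t)" by (intro continuous_intros hump_continuous)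
  then show ?thesis
    using h assms unfolding hump_def strict_mono_on_def by simp
qed

section \<open>Slope comparison for the antiderivative of a half-wave\<close>

context
  fixes F :: "real \<Rightarrow> real"
  assumes dF: "\<And>t. (F has_real_derivative \<phi> t) (at t)"
    and antiF: "\<And>t. F (t + T) = - F t"
begin

text \<open>Symmetry of \<open>\<phi>\<close> about \<open>C\<close> makes
  \<open>F (2 * C - t) + F t\<close> constant, and antiperiodicity makes this constant equal to its
  own negative.\<close>

lemma hump_integral_odd: "F (2 * C - t) = - F t"
proof -
  have "((\<lambda>t. F (2 * C - t) + F t) has_real_derivative 0) (at t)" for t
    using hump_reflect[of t] by (auto intro!: derivative_eq_intros DERIV_chain2[OF dF])
  then have "F (2 * C - t) + F t = F (2 * C - 0) + F 0" for t
    by (rule DERIV_isconst_all[rule_format])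
  then obtain K where K: "\<And>t. F (2 * C - t) + F t = K" by blast
  have "F (2 * C - t - T) = - F (2 * C - t)"
    using antiF[of "2 * C - t - T"] by simp
  then show ?thesis
    using K[of t] K[of "t + T"] antiF[of t] by (simp add: algebra_simps)
qed

lemma hump_integral_continuous: "continuous_on A F"
  by (meson DERIV_isCont continuous_at_imp_continuous_on dF)

lemma hump_integral_less:
  assumes "C - w \<le> s" "s < t" "t \<le> C + w" shows "F s < F t"
proof (rule DERIV_pos_imp_increasing_open[OF assms(2)])
  show "\<exists>D. (F has_real_derivative D) (at x) \<and> 0 < D" if "s < x" "x < t" for x
    using dF[of x] hump_pos[of x] that assms by auto
qed (rule hump_integral_continuous)

lemma hump_integral_center: "F C = 0"
  using hump_integral_odd[of C] by simp

lemma hump_integral_left: "F (C - w) = - F (C + w)"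
  using hump_integral_odd[of "C + w"] by (simp add: algebra_simps)

text \<open>The positive half-wave of \<open>F\<close> starts at \<open>C\<close>, where
  \<open>F\<close> vanishes, and climbs until \<open>C + w\<close>, where \<open>\<phi>\<close>
  returns to zero. A plateau of \<open>\<phi>\<close> at zero thus becomes a plateau of
  \<open>F\<close> at the top, while \<open>F\<close>, with half-width \<open>T / 2\<close>, has no
  plateau at zero.\<close>

lemma hump_integral: "hump F (C + T / 2) (T / 2) w (F (C + w)) T"
  unfolding hump_def
proof (intro conjI allI ballI)
  show "F (2 * (C + T / 2) - t) = F t" for t
    using hump_integral_odd[of "t - T"] antiF[of "t - T"] by (simp add: algebra_simps)
  show "F (C + T / 2 - T / 2) = 0" using hump_integral_center by simp
  show "strict_mono_on {C + T / 2 - T / 2..C + T / 2 - T / 2 + w} F"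
    using hump_integral_less hump_dims by (auto simp: strict_mono_on_def)
  show "F t = F (C + w)" if "t \<in> {C + T / 2 - T / 2 + w..C + T / 2}" for t
  proof (cases "C + w < t")
    case True
    show ?thesis
    proof (rule DERIV_isconst2[OF True])
      show "(F has_real_derivative 0) (at x)" if "C + w < x" "x < t" for x
        using dF[of x] hump_gap[of x] that \<open>t \<in> _\<close> by auto
    qed (use hump_integral_continuous True in auto)
  next
    case False
    then have "t = C + w" using that by auto
    then show ?thesis by simp
  qed
  show "F t = 0" if "t \<in> {C + T / 2 + T / 2..C + T / 2 + T / 2}" for t
    using antiF[of C] hump_integral_center that by (simp add: add.assoc)
qed (use hump_dims antiF hump_integral_continuous in auto)

text \<open>If \<open>y \<tau>\<close> were below \<open>- \<phi> \<xi>\<close>, there would be a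
  point \<open>\<xi>1\<close> further up the rising branch with
  \<open>\<phi> \<xi>1 = - y \<tau>\<close>; \<open>\<bar>y \<tau>\<bar> \<le> M\<close> ensures
  that this height is reached. By domination, \<open>Y\<close> then falls after
  \<open>\<tau>\<close> at least as fast as \<open>F\<close> does on the way back from
  \<open>\<xi>1\<close> to \<open>C - w\<close>. Since it starts from the smaller value
  \<open>F \<xi>\<close>, it drops below the minimum \<open>- F (C + w)\<close>.\<close>

lemma slope_bound_left:
  assumes d: "dominated y \<phi> (C - w) (C - w + q)"
    and dY: "\<And>t. (Y has_real_derivative y t) (at t)"
    and y: "\<And>t. \<bar>y t\<bar> \<le> M" and Y: "\<And>t. \<bar>Y t\<bar> \<le> F (C + w)"
    and \<xi>: "C - w \<le> \<xi>" "\<xi> \<le> C" and eq: "Y \<tau> = F \<xi>"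
  shows "- \<phi> \<xi> \<le> y \<tau>"
proof (rule ccontr)
  assume "\<not> ?thesis"
  then have less: "\<phi> \<xi> < - y \<tau>" by simp
  have le: "- y \<tau> \<le> M" using y[of \<tau>] by linarith
  then have "\<xi> < C - w + q" using less hump_plateau[of \<xi>] \<xi> by force
  then obtain \<xi>1 where \<xi>1: "\<xi> \<le> \<xi>1" "\<xi>1 \<le> C - w + q" "\<phi> \<xi>1 = - y \<tau>"
    using IVT'[of \<phi> \<xi> "- y \<tau>" "C - w + q"] less le hump_max hump_continuous by auto
  then have "\<xi> < \<xi>1" using less by (cases "\<xi> = \<xi>1") auto
  define S where "S = \<xi>1 - (C - w)"
  have "0 \<le> S" using \<xi> \<xi>1 by (simp add: S_def)
  have dec: "Y (\<tau> + S) - F (\<xi>1 - S) \<le> Y (\<tau> + 0) - F (\<xi>1 - 0)"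
  proof (rule DERIV_nonpos_imp_nonincreasing[OF \<open>0 \<le> S\<close>])
    fix s assume s: "0 \<le> s" "s \<le> S"
    have "((\<lambda>s. Y (\<tau> + s) - F (\<xi>1 - s)) has_real_derivative y (\<tau> + s) + \<phi> (\<xi>1 - s)) (at s)"
      by (auto intro!: derivative_eq_intros DERIV_chain2[OF dF] DERIV_chain2[OF dY])
    moreover have "\<phi> (\<xi>1 - s) \<le> -1 * y (\<tau> + 1 * s)"
      by (rule dominatedD[OF d]) (use s \<xi>1 in \<open>auto simp: S_def\<close>)
    ultimately show "\<exists>D. ((\<lambda>s. Y (\<tau> + s) - F (\<xi>1 - s)) has_real_derivative D) (at s) \<and> D \<le> 0"
      by force
  qed
  moreover have "F \<xi> < F \<xi>1" using hump_integral_less[of \<xi> \<xi>1] \<xi> \<xi>1 \<open>\<xi> < \<xi>1\<close> hump_dims by simp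
  ultimately have "Y (\<tau> + S) < - F (C + w)"
    using eq hump_integral_left by (simp add: S_def)
  then show False using Y[of "\<tau> + S"] by linarith
qed

text \<open>To the right of the centre, \<open>Y\<close> is replaced by \<open>- Y (- t)\<close>.
  This preserves slopes and, as \<open>F\<close> is odd about \<open>C\<close>, moves
  \<open>\<xi>\<close> to \<open>2 * C - \<xi>\<close>.\<close>

lemma slope_bound:
  assumes d: "dominated y \<phi> (C - w) (C - w + q)"
    and dY: "\<And>t. (Y has_real_derivative y t) (at t)"
    and y: "\<And>t. \<bar>y t\<bar> \<le> M" and Y: "\<And>t. \<bar>Y t\<bar> \<le> F (C + w)"
    and \<xi>: "C - w \<le> \<xi>" "\<xi> \<le> C + w" and eq: "Y \<tau> = F \<xi>"
  shows "- \<phi> \<xi> \<le> y \<tau>"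
proof (cases "\<xi> \<le> C")
  case True
  then show ?thesis using slope_bound_left[OF d dY y Y \<xi>(1) _ eq] by simp
next
  case False
  have "- \<phi> (2 * C - \<xi>) \<le> 1 * y (-1 * (- \<tau>))"
  proof (rule slope_bound_left[where Y = "\<lambda>t. - Y (- t)" and y = "\<lambda>t. 1 * y (- 1 * t)" and \<tau> = "- \<tau>"])
    show "dominated (\<lambda>t. 1 * y (-1 * t)) \<phi> (C - w) (C - w + q)"
      by (rule dominated_transform[OF d]) auto
    show "((\<lambda>t. - Y (- t)) has_real_derivative 1 * y (- 1 * t)) (at t)" for t
      by (auto intro!: derivative_eq_intros DERIV_chain2[OF dY])
    show "- Y (- (- \<tau>)) = F (2 * C - \<xi>)" using eq hump_integral_odd by simp
  qed (use y Y False \<xi> in auto)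
  then show ?thesis using hump_reflect by simp
qed

end

end

text \<open>At its first zero \<open>u\<close> would arrive from positive values, which a positive
  derivative there forbids.\<close>

lemma barrier_pos:
  fixes u :: "real \<Rightarrow> real"
  assumes du: "\<And>t. (u has_real_derivative u' t) (at t)" and "0 < u 0"
    and up: "\<And>t. 0 \<le> t \<Longrightarrow> t \<le> s \<Longrightarrow> u t = 0 \<Longrightarrow> 0 < u' t" and t: "0 \<le> t" "t \<le> s"
  shows "0 < u t"
proof (rule ccontr)
  assume "\<not> ?thesis"
  define A where "A = {a \<in> {0..t}. u a \<le> 0}"
  have cont: "continuous_on S u" for S
    by (meson DERIV_isCont continuous_at_imp_continuous_on du)
  have "A = {0..t} \<inter> {a. u a \<le> 0}" by (auto simp: A_def)
  moreover have "closed {a. u a \<le> 0}" by (intro closed_Collect_le cont continuous_on_const)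
  ultimately have "compact A" by (simp add: compact_Int_closed)
  moreover have "t \<in> A" using \<open>\<not> 0 < u t\<close> t by (simp add: A_def)
  ultimately obtain a where a: "a \<in> A" "\<And>b. b \<in> A \<Longrightarrow> a \<le> b"
    using compact_attains_inf[of A] by blast
  have pos: "0 < u b" if "0 \<le> b" "b < a" for b
    using a(2)[of b] a(1) that by (force simp: A_def)
  have "0 < a" using a(1) \<open>0 < u 0\<close> by (cases "a = 0") (auto simp: A_def)
  have "\<exists>b\<ge>0. b \<le> a \<and> u b = 0"
    using IVT2'[of u a 0 0] a(1) \<open>0 < u 0\<close> cont by (auto simp: A_def)
  then obtain b where "0 \<le> b" "b \<le> a" "u b = 0" by blast
  then have "u a = 0" using pos[of b] by (cases "b = a") auto
  then have "0 < u' a" using up[of a] a(1) t by (simp add: A_def)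
  then obtain e where e: "e > 0" "\<And>h. 0 < h \<Longrightarrow> h < e \<Longrightarrow> u (a - h) < u a"
    using DERIV_pos_inc_left[OF du] by blast
  define h where "h = min e a / 2"
  have "0 < h" "h < e" "h < a" using e(1) \<open>0 < a\<close> by (auto simp: h_def)
  then show False using e(2)[of h] pos[of "a - h"] \<open>u a = 0\<close> by simp
qed

lemma dominated_integral:
  assumes h: "hump \<phi> C w q M T"
    and dF: "\<And>t. (F has_real_derivative \<phi> t) (at t)" and antiF: "\<And>t. F (t + T) = - F t"
    and d: "dominated y \<phi> (C - w) (C - w + q)"
    and dY: "\<And>t. (Y has_real_derivative y t) (at t)"
    and y: "\<And>t. \<bar>y t\<bar> \<le> M" and Y: "\<And>t. \<bar>Y t\<bar> \<le> F (C + w)"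
  shows "dominated Y F (C - w) (C + w)"
proof -
  have main: "F (\<xi> - s) \<le> Z (\<tau> + s)"
    if d: "dominated z \<phi> (C - w) (C - w + q)"
      and dZ: "\<And>t. (Z has_real_derivative z t) (at t)"
      and z: "\<And>t. \<bar>z t\<bar> \<le> M" and Z: "\<And>t. \<bar>Z t\<bar> \<le> F (C + w)"
      and s: "C - w \<le> \<xi> - s" "0 \<le> s" and \<xi>: "\<xi> \<le> C + w" and le: "F \<xi> \<le> Z \<tau>"
    for z Z \<tau> \<xi> s
  proof (cases "\<xi> - s = C - w")
    case True
    then show ?thesis using Z[of "\<tau> + s"] hump_integral_left[OF h dF antiF] by (simp add: abs_le_iff)
  next
    case False
    \<comment> \<open>For \<open>e < \<epsilon>0\<close> the accelerated argument
      \<open>\<xi> - e - (1 + e) * t\<close> stays to the right of \<open>C - w\<close> up to time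
      \<open>s\<close>, hence in the region where \<open>\<phi>\<close> is positive.\<close>
    define \<epsilon>0 where "\<epsilon>0 = (\<xi> - s - (C - w)) / (1 + s)"
    have "\<epsilon>0 > 0" using False s by (simp add: \<epsilon>0_def)
    \<comment> \<open>The comparison function is started strictly below and run slightly too fast, so that at a first
      contact the derivatives are strictly ordered.\<close>
    have less: "F (\<xi> - e - (1 + e) * s) < Z (\<tau> + s)" if e: "0 < e" "e < \<epsilon>0" for e
    proof -
      have e1: "e * (1 + s) < \<xi> - s - (C - w)"
        using e(2) s by (simp add: \<epsilon>0_def pos_less_divide_eq)
      have pt: "C - w < \<xi> - e - (1 + e) * t" "\<xi> - e - (1 + e) * t < C + w" if "0 \<le> t" "t \<le> s" for t
      proof -
        have "e * t \<le> e * s" using that e by simp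
        then show "C - w < \<xi> - e - (1 + e) * t" using that e1 by (simp add: algebra_simps)
        have "0 \<le> (1 + e) * t" using that e by simp
        then show "\<xi> - e - (1 + e) * t < C + w" using e \<xi> by linarith
      qed
      have "0 < Z (\<tau> + s) - F (\<xi> - e - (1 + e) * s)"
      proof (rule barrier_pos[where u = "\<lambda>t. Z (\<tau> + t) - F (\<xi> - e - (1 + e) * t)" and s = s
            and u' = "\<lambda>t. z (\<tau> + t) + (1 + e) * \<phi> (\<xi> - e - (1 + e) * t)"])
        show "((\<lambda>t. Z (\<tau> + t) - F (\<xi> - e - (1 + e) * t)) has_real_derivative
            z (\<tau> + t) + (1 + e) * \<phi> (\<xi> - e - (1 + e) * t)) (at t)" for t
          by (auto intro!: derivative_eq_intros DERIV_chain2[OF dF] DERIV_chain2[OF dZ] simp: algebra_simps)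
        show "0 < Z (\<tau> + 0) - F (\<xi> - e - (1 + e) * 0)"
          using hump_integral_less[OF h dF antiF, of "\<xi> - e" \<xi>] le pt(1)[of 0] s e \<xi> by simp
        show "0 < z (\<tau> + t) + (1 + e) * \<phi> (\<xi> - e - (1 + e) * t)"
          if "0 \<le> t" "t \<le> s" "Z (\<tau> + t) - F (\<xi> - e - (1 + e) * t) = 0" for t
        proof -
          have "- \<phi> (\<xi> - e - (1 + e) * t) \<le> z (\<tau> + t)"
            by (rule slope_bound[OF h dF antiF d dZ z Z]) (use pt[OF that(1,2)] that(3) in auto)
          moreover have "0 < e * \<phi> (\<xi> - e - (1 + e) * t)"
            using hump_pos[OF h pt[OF that(1,2)]] e by simp
          ultimately show ?thesis by (simp add: algebra_simps)
        qed
      qed (use s in auto)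
      then show ?thesis by simp
    qed
    show ?thesis
    proof (rule tendsto_upperbound)
      have "isCont F t" for t using dF DERIV_isCont by blast
      moreover have "((\<lambda>e. \<xi> - e - (1 + e) * s) \<longlongrightarrow> \<xi> - 0 - (1 + 0) * s) (at_right 0)"
        by (intro tendsto_intros)
      ultimately show "((\<lambda>e. F (\<xi> - e - (1 + e) * s)) \<longlongrightarrow> F (\<xi> - s)) (at_right 0)"
        using isCont_tendsto_compose[of "\<xi> - s" F] by simp
      show "\<forall>\<^sub>F e in at_right 0. F (\<xi> - e - (1 + e) * s) \<le> Z (\<tau> + s)"
        using less \<open>\<epsilon>0 > 0\<close> unfolding eventually_at_right_field by (auto intro!: exI[of _ \<epsilon>0] less_imp_le)
    qed simp
  qed
  show ?thesis
    unfolding dominated_def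
  proof (intro allI ballI impI)
    fix \<tau> \<xi> s \<sigma> \<delta> :: real
    assume *: "\<sigma> \<in> {1, -1}" "\<delta> \<in> {1, -1}" "C - w \<le> \<xi> - s" "0 \<le> s" "\<xi> \<le> C + w" "F \<xi> \<le> \<sigma> * Y \<tau>"
    have \<delta>\<delta>: "\<delta> * (\<delta> * t) = t" for t using *(2) by auto
    have "F (\<xi> - s) \<le> \<sigma> * Y (\<delta> * (\<delta> * \<tau> + s))"
    proof (rule main[where z = "\<lambda>t. (\<sigma> * \<delta>) * y (\<delta> * t)" and Z = "\<lambda>t. \<sigma> * Y (\<delta> * t)"])
      show "dominated (\<lambda>t. \<sigma> * \<delta> * y (\<delta> * t)) \<phi> (C - w) (C - w + q)"
        by (rule dominated_transform[OF d]) (use * in auto)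
      show "((\<lambda>t. \<sigma> * Y (\<delta> * t)) has_real_derivative \<sigma> * \<delta> * y (\<delta> * t)) (at t)" for t
        by (auto intro!: derivative_eq_intros DERIV_chain2[OF dY])
      show "\<bar>\<sigma> * \<delta> * y (\<delta> * t)\<bar> \<le> M" "\<bar>\<sigma> * Y (\<delta> * t)\<bar> \<le> F (C + w)" for t
        using *(1,2) y[of "\<delta> * t"] Y[of "\<delta> * t"] by (auto simp: abs_mult)
    qed (use * \<delta>\<delta> in auto)
    then show "F (\<xi> - s) \<le> \<sigma> * Y (\<tau> + \<delta> * s)"
      using \<delta>\<delta> by (simp add: distrib_left)
  qed
qed

text \<open>Around a point where \<open>y\<close> nearly attains \<open>M\<close> in modulus,
  domination in both directions of time forces \<open>Y\<close> to change by at least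
  \<open>2 * (F \<xi> - F (C - w))\<close> over a symmetric interval, and \<open>\<xi>\<close> may
  be taken close to \<open>C\<close>. If \<open>\<phi>\<close> had a plateau, \<open>\<xi>\<close>
  could only be brought close to its left end, and the rise across the plateau would be
  lost.\<close>

lemma dominated_peak_rise:
  assumes h: "hump \<phi> C w w M T"
    and dF: "\<And>t. (F has_real_derivative \<phi> t) (at t)" and antiF: "\<And>t. F (t + T) = - F t"
    and d: "dominated y \<phi> (C - w) C"
    and dY: "\<And>t. (Y has_real_derivative y t) (at t)"
    and sup: "\<And>e. e > 0 \<Longrightarrow> \<exists>t. M - e < \<bar>y t\<bar>" and Y: "\<And>t. \<bar>Y t\<bar> \<le> N"
  shows "F (C + w) \<le> N"
proof -
  have step: "F \<xi> + F (C + w) \<le> N" if \<xi>: "C - w \<le> \<xi>" "\<xi> < C" for \<xi>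
  proof -
    have "\<phi> \<xi> < M" using hump_less[OF h \<xi>] hump_max[OF h] by simp
    then obtain \<tau> where "M - (M - \<phi> \<xi>) < \<bar>y \<tau>\<bar>" using sup[of "M - \<phi> \<xi>"] by auto
    then obtain \<sigma> where \<sigma>: "\<sigma> \<in> {1, -1}" "\<phi> \<xi> \<le> \<sigma> * y \<tau>"
      using that[of 1] that[of "-1"] by (cases "0 \<le> y \<tau>") auto
    define S where "S = \<xi> - (C - w)"
    have "0 \<le> S" using \<xi> by (simp add: S_def)
    have "\<sigma> * (Y (\<tau> + 0) - Y (\<tau> - 0)) + 2 * F (\<xi> - 0) \<le> \<sigma> * (Y (\<tau> + S) - Y (\<tau> - S)) + 2 * F (\<xi> - S)"
    proof (rule DERIV_nonneg_imp_nondecreasing[OF \<open>0 \<le> S\<close>])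
      fix s assume s: "0 \<le> s" "s \<le> S"
      have "((\<lambda>s. \<sigma> * (Y (\<tau> + s) - Y (\<tau> - s)) + 2 * F (\<xi> - s)) has_real_derivative
          \<sigma> * (y (\<tau> + s) + y (\<tau> - s)) - 2 * \<phi> (\<xi> - s)) (at s)"
        by (auto intro!: derivative_eq_intros DERIV_chain2[OF dF] DERIV_chain2[OF dY])
      moreover have "\<phi> (\<xi> - s) \<le> \<sigma> * y (\<tau> + \<delta> * s)" if "\<delta> \<in> {1, -1}" for \<delta>
        by (rule dominatedD[OF d \<sigma>(1) that _ _ _ \<sigma>(2)]) (use s \<xi> in \<open>auto simp: S_def\<close>)
      from this[of 1] this[of "-1"] have "0 \<le> \<sigma> * (y (\<tau> + s) + y (\<tau> - s)) - 2 * \<phi> (\<xi> - s)"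
        by (simp add: distrib_left)
      ultimately show "\<exists>D. ((\<lambda>s. \<sigma> * (Y (\<tau> + s) - Y (\<tau> - s)) + 2 * F (\<xi> - s)) has_real_derivative D) (at s) \<and> 0 \<le> D"
        by blast
    qed
    moreover have "\<sigma> * (Y (\<tau> + S) - Y (\<tau> - S)) \<le> 2 * N"
      using \<sigma>(1) Y[of "\<tau> + S"] Y[of "\<tau> - S"] by (auto simp: abs_le_iff)
    ultimately show ?thesis
      using hump_integral_left[OF h dF antiF] by (simp add: S_def)
  qed
  have "F C + F (C + w) \<le> N"
  proof (rule tendsto_upperbound)
    have "(F \<longlongrightarrow> F C) (at_left C)"
      using dF DERIV_isCont by (metis isCont_def tendsto_within_subset subset_UNIV filterlim_at_split)
    then show "((\<lambda>\<xi>. F \<xi> + F (C + w)) \<longlongrightarrow> F C + F (C + w)) (at_left C)"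
      by (intro tendsto_intros)
    show "\<forall>\<^sub>F \<xi> in at_left C. F \<xi> + F (C + w) \<le> N"
      unfolding eventually_at_left_field
      using step hump_dims[OF h] by (intro exI[of _ "C - w"]) auto
  qed simp
  then show ?thesis using hump_integral_center[OF h dF antiF] by simp
qed

text \<open>The induction has to treat \<open>c * \<phi> k\<close> for all \<open>c \<ge> 1\<close>: if \<open>y k\<close> exceeded \<open>c * M k\<close>, then \<open>y k\<close> would
  be dominated by the larger multiple of \<open>\<phi> k\<close> that has the same norm, and near its extremum \<open>y (Suc k)\<close> would
  rise by too much. A plateau of \<open>\<phi> k\<close> breaks this argument, hence the assumption \<open>no_plateau\<close>.\<close>

theorem comparison_chain:
  fixes y \<phi> :: "nat \<Rightarrow> real \<Rightarrow> real" and C w q M :: "nat \<Rightarrow> real"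
  assumes "r \<ge> 2"
    and h: "\<And>k. 1 \<le> k \<Longrightarrow> hump (\<phi> k) (C k) (w k) (q k) (M k) T"
    and next_hump: "\<And>k. 1 \<le> k \<Longrightarrow> C (Suc k) = C k + T / 2" "\<And>k. 1 \<le> k \<Longrightarrow> q (Suc k) = w k"
      "\<And>k. 1 \<le> k \<Longrightarrow> w (Suc k) = T / 2" "\<And>k. 1 \<le> k \<Longrightarrow> M (Suc k) = \<phi> (Suc k) (C k + w k)"
    and d\<phi>: "\<And>k t. 1 \<le> k \<Longrightarrow> (\<phi> (Suc k) has_real_derivative \<phi> k t) (at t)"
    and dy: "\<And>k t. 1 \<le> k \<Longrightarrow> k < r \<Longrightarrow> (y (Suc k) has_real_derivative y k t) (at t)"
    and base: "\<And>c. 1 \<le> c \<Longrightarrow> dominated (y 1) (\<lambda>t. c * \<phi> 1 t) (C 1 - w 1) (C 1 - w 1 + q 1)"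
    and no_plateau: "\<And>k. 1 \<le> k \<Longrightarrow> k < r \<Longrightarrow> q k = w k \<or> (\<forall>t. \<bar>y k t\<bar> \<le> M k)"
    and bdd: "\<And>k. 1 \<le> k \<Longrightarrow> k \<le> r \<Longrightarrow> \<exists>K. \<forall>t. \<bar>y k t\<bar> \<le> K"
    and top: "\<And>t. \<bar>y r t\<bar> \<le> M r"
  shows "dominated (y r) (\<phi> r) (C r - T / 2 - q r) (C r - T / 2 + q r)"
proof -
  define P where "P k \<longleftrightarrow> (\<forall>c\<ge>1. (\<forall>t. \<bar>y k t\<bar> \<le> c * M k) \<longrightarrow>
      dominated (y k) (\<lambda>t. c * \<phi> k t) (C k - w k) (C k - w k + q k))" for k
  have step: "dominated (y (Suc k)) (\<lambda>t. c * \<phi> (Suc k) t) (C k - w k) (C k + w k)"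
    if k: "1 \<le> k" "k < r" "P k" and c: "1 \<le> c" "\<And>t. \<bar>y (Suc k) t\<bar> \<le> c * M (Suc k)" for k c
  proof -
    note hk = h[OF k(1)]
    have M: "0 < M k" "0 < M (Suc k)"
      using hump_max(2)[OF hk] hump_max(2)[OF h[of "Suc k"]] by auto
    have scaled: "hump (\<lambda>t. b * \<phi> k t) (C k) (w k) (q k) (b * M k) T" if "b > 0" for b
      by (rule hump_scale[OF hk that])
    have dF: "((\<lambda>t. b * \<phi> (Suc k) t) has_real_derivative b * \<phi> k t) (at t)" for b t
      by (rule DERIV_cmult[OF d\<phi>[OF k(1)]])
    have antiF: "b * \<phi> (Suc k) (t + T) = - (b * \<phi> (Suc k) t)" for b t
      using hump_antiperiodic(1)[OF h[of "Suc k"]] by simp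
    have small: "\<bar>y k t\<bar> \<le> c * M k" for t
    proof (rule ccontr)
      assume t: "\<not> \<bar>y k t\<bar> \<le> c * M k"
      obtain K0 where K0: "\<And>t. \<bar>y k t\<bar> \<le> K0" using bdd[of k] k by auto
      define K where "K = (SUP t. \<bar>y k t\<bar>)"
      have bddK: "bdd_above (range (\<lambda>t. \<bar>y k t\<bar>))" by (rule bdd_aboveI2) (rule K0)
      have K: "\<bar>y k t\<bar> \<le> K" for t unfolding K_def by (rule cSUP_upper[OF _ bddK]) simp
      define b where "b = K / M k"
      have b: "b * M k = K" using M by (simp add: b_def)
      have "c < b"
      proof -
        have "c * M k < K" using t K[of t] by simp
        then show ?thesis using M by (simp add: b_def pos_less_divide_eq)
      qed
      have "M k < \<bar>y k t\<bar>"
      proof -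
        have "1 * M k \<le> c * M k" using c M by (intro mult_right_mono) auto
        then show ?thesis using t by simp
      qed
      then have q: "q k = w k" using no_plateau[OF k(1,2)] by (meson not_le)
      have dk: "dominated (y k) (\<lambda>t. b * \<phi> k t) (C k - w k) (C k)"
        using \<open>P k\<close>[unfolded P_def, rule_format, of b] K b c(1) \<open>c < b\<close> q by simp
      have "b * \<phi> (Suc k) (C k + w k) \<le> c * M (Suc k)"
      proof (rule dominated_peak_rise[OF _ dF antiF dk dy])
        show "hump (\<lambda>t. b * \<phi> k t) (C k) (w k) (w k) (b * M k) T"
          using scaled[of b] q c(1) \<open>c < b\<close> by simp
        show "\<exists>t. b * M k - e < \<bar>y k t\<bar>" if "e > 0" for e
        proof -
          have "K - e < (SUP t. \<bar>y k t\<bar>)" unfolding K_def using that by simp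
          then show ?thesis unfolding b by (subst (asm) less_cSUP_iff[OF _ bddK]) auto
        qed
      qed (use k c in auto)
      then have "b * M (Suc k) \<le> c * M (Suc k)" using next_hump(4)[OF k(1)] by simp
      then show False using \<open>c < b\<close> M by simp
    qed
    show ?thesis
    proof (rule dominated_integral[OF _ dF antiF _ dy])
      show "hump (\<lambda>t. c * \<phi> k t) (C k) (w k) (q k) (c * M k) T"
        using scaled[of c] c by simp
      show "dominated (y k) (\<lambda>t. c * \<phi> k t) (C k - w k) (C k - w k + q k)"
        using \<open>P k\<close>[unfolded P_def, rule_format, of c] small c(1) by simp
    qed (use k small c next_hump(4)[OF k(1)] in auto)
  qed
  have P: "P k" if "1 \<le> k" "k < r" for k
    using that
  proof (induction k rule: nat_induct_at_least)
    case base
    then show ?case using assms(9) by (simp add: P_def)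
  next
    case (Suc k)
    then have "P k" by simp
    show ?case
      unfolding P_def
    proof (intro allI impI)
      fix c :: real assume "1 \<le> c" "\<forall>t. \<bar>y (Suc k) t\<bar> \<le> c * M (Suc k)"
      then have "dominated (y (Suc k)) (\<lambda>t. c * \<phi> (Suc k) t) (C k - w k) (C k + w k)"
        using step[of k c] Suc \<open>P k\<close> by simp
      then show "dominated (y (Suc k)) (\<lambda>t. c * \<phi> (Suc k) t) (C (Suc k) - w (Suc k)) (C (Suc k) - w (Suc k) + q (Suc k))"
        by (rule dominated_subset) (use next_hump[of k] Suc.hyps hump_dims[OF h[of k]] in auto)
    qed
  qed
  \<comment> \<open>The last integration is done outside \<open>P\<close>: the conclusion concerns
    the branch from minimum to maximum, of which \<open>P\<close> keeps the upper half.\<close>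
  obtain k where k: "r = Suc k" "1 \<le> k" using \<open>r \<ge> 2\<close> by (cases r) auto
  have "dominated (y (Suc k)) (\<lambda>t. 1 * \<phi> (Suc k) t) (C k - w k) (C k + w k)"
    by (rule step) (use k P[of k] top in auto)
  then show ?thesis using next_hump[OF k(2)] by (simp add: k(1))
qed

text \<open>At an extreme value \<open>x\<close> has an extremum and \<open>X = 0\<close>. At any
  other value, domination makes
  \<open>\<sigma> * (x (\<tau> + \<delta> * s) - \<phi> (\<xi> - s))\<close> nonnegative for small
  \<open>s > 0\<close>, and it is zero for \<open>s = 0\<close>. Its derivative yields
  \<open>0 \<le> \<sigma> * (\<delta> * X + D)\<close>, and the two directions of time together
  bound the modulus of \<open>X\<close>.\<close>

lemma dominated_slope:
  assumes h: "hump \<phi> C (T / 2) q M T" and d: "dominated x \<phi> (C - T / 2 - q) (C - T / 2 + q)"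
    and x: "\<And>t. \<bar>x t\<bar> \<le> M" and eq: "x \<tau> = \<phi> \<xi>"
    and dx: "(x has_real_derivative X) (at \<tau>)" and d\<phi>: "(\<phi> has_real_derivative D) (at \<xi>)"
  shows "\<bar>X\<bar> \<le> \<bar>D\<bar>"
proof (cases "\<bar>x \<tau>\<bar> = M")
  case True
  have "X = 0"
  proof (cases "x \<tau> = M")
    case True
    then show ?thesis
      using x by (intro DERIV_local_max[OF dx, of 1]) (auto simp: abs_le_iff)
  next
    case False
    then have "x \<tau> = - M" using True by linarith
    then show ?thesis
      using x by (intro DERIV_local_min[OF dx, of 1]) (auto simp: abs_le_iff minus_le_iff)
  qed
  then show ?thesis by simp
next
  case False
  \<comment> \<open>This half period contains the rising branch from \<open>- M\<close> to
    \<open>M\<close>, with half a plateau on either side. The plateaus are excluded because the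
    value is not extreme.\<close>
  obtain u \<sigma> where \<sigma>: "\<sigma> \<in> {1, -1}" and u: "C - T \<le> u" "u < C - T + T"
    and \<phi>: "\<And>v. \<phi> (\<xi> + v) = \<sigma> * \<phi> (u + v)"
    by (rule hump_reduce[OF h, of "C - T" \<xi>]) (rule that)
  have x\<tau>: "\<sigma> * x \<tau> = \<phi> u" using \<phi>[of 0] eq \<sigma> by auto
  have "\<bar>\<phi> u\<bar> \<noteq> M" using False \<phi>[of 0] eq \<sigma> by auto
  have "u < C - T / 2 + q"
    using hump_plateau[OF h, of u] hump_max[OF h] u \<open>\<bar>\<phi> u\<bar> \<noteq> M\<close> by force
  moreover have "C - T / 2 - q < u"
  proof (rule ccontr)
    assume "\<not> ?thesis"
    then have "\<phi> (2 * C - u - T) = M" using u by (intro hump_plateau[OF h]) auto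
    then show False
      using hump_antiperiodic(2)[OF h, of "2 * C - u"] hump_reflect[OF h, of u] hump_max[OF h] \<open>\<bar>\<phi> u\<bar> \<noteq> M\<close> by simp
  qed
  ultimately have u': "C - T / 2 - q < u" "u \<le> C - T / 2 + q" by auto
  have "0 \<le> \<sigma> * (\<delta> * X + D)" if \<delta>: "\<delta> \<in> {1, -1}" for \<delta>
  proof (rule ccontr)
    assume neg: "\<not> ?thesis"
    define g where "g s = \<sigma> * (x (\<tau> + \<delta> * s) - \<phi> (\<xi> - s))" for s
    have "(g has_real_derivative \<sigma> * (\<delta> * X + D)) (at 0)"
      unfolding g_def
      by (auto intro!: derivative_eq_intros DERIV_chain2[where f = x and Da = X] DERIV_chain2[where f = \<phi> and Da = D]
          simp: dx d\<phi> algebra_simps)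
    then obtain e where e: "0 < e" "\<And>h. 0 < h \<Longrightarrow> h < e \<Longrightarrow> g (0 + h) < g 0"
      using DERIV_neg_dec_right[of g "\<sigma> * (\<delta> * X + D)" 0] neg by force
    define s where "s = min (e / 2) (u - (C - T / 2 - q))"
    have s: "0 < s" "s < e" "C - T / 2 - q \<le> u - s" using e(1) u' by (auto simp: s_def)
    have "\<phi> (u - s) \<le> \<sigma> * x (\<tau> + \<delta> * s)"
      by (rule dominatedD[OF d \<sigma> \<delta> s(3) _ u'(2)]) (use s x\<tau> in auto)
    moreover have "\<sigma> * \<phi> (\<xi> - s) = \<phi> (u - s)" using \<phi>[of "- s"] \<sigma> by auto
    ultimately have "0 \<le> g s"
      by (simp add: g_def right_diff_distrib)
    moreover have "g 0 = 0" using eq by (simp add: g_def)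
    ultimately show False using e(2)[of s] s by simp
  qed
  from this[of 1] this[of "-1"] show ?thesis using \<sigma> by auto
qed

text \<open>For the induction step, the increments \<open>y (t + s) - y t\<close> with \<open>s\<close> in the unit interval form a chain that
  is shorter by one, because an increment of the Lipschitz function \<open>y 1\<close> is bounded.\<close>

lemma penultimate_derivative_bounded:
  assumes "m \<ge> 1"
  shows "\<exists>K. \<forall>y :: nat \<Rightarrow> real \<Rightarrow> real.
    (\<forall>k t. 1 \<le> k \<longrightarrow> k \<le> m \<longrightarrow> (y (Suc k) has_real_derivative y k t) (at t)) \<longrightarrow>
    (\<forall>t. \<bar>y (Suc m) t\<bar> \<le> A) \<longrightarrow> (\<forall>s t. \<bar>y 1 s - y 1 t\<bar> \<le> A * \<bar>s - t\<bar>) \<longrightarrow> (\<forall>t. \<bar>y m t\<bar> \<le> K)"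
  using assms
proof (induction m arbitrary: A rule: nat_induct_at_least)
  case base
  show ?case
  proof (intro exI[of _ "3 * A"] allI impI)
    fix y :: "nat \<Rightarrow> real \<Rightarrow> real" and t
    assume dy: "\<forall>k t. 1 \<le> k \<longrightarrow> k \<le> 1 \<longrightarrow> (y (Suc k) has_real_derivative y k t) (at t)"
      and y2: "\<forall>t. \<bar>y (Suc 1) t\<bar> \<le> A" and y1: "\<forall>s t. \<bar>y 1 s - y 1 t\<bar> \<le> A * \<bar>s - t\<bar>"
    obtain z where z: "t < z" "z < t + 1" "y (Suc 1) (t + 1) - y (Suc 1) t = (t + 1 - t) * y 1 z"
      using MVT2[of t "t + 1" "y (Suc 1)" "y 1"] dy by auto
    have "0 \<le> A" using y2[rule_format, of 0] by linarith
    have "\<bar>y 1 t\<bar> \<le> \<bar>y 1 z\<bar> + A * \<bar>t - z\<bar>" using y1[rule_format, of t z] by linarith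
    also have "A * \<bar>t - z\<bar> \<le> A * 1" using z \<open>0 \<le> A\<close> by (intro mult_left_mono) auto
    also have "\<bar>y 1 z\<bar> \<le> 2 * A"
      using z(3) y2[rule_format, of t] y2[rule_format, of "t + 1"] by simp
    finally show "\<bar>y 1 t\<bar> \<le> 3 * A" by simp
  qed
next
  case (Suc m)
  obtain K where K: "\<And>y :: nat \<Rightarrow> real \<Rightarrow> real.
    (\<forall>k t. 1 \<le> k \<longrightarrow> k \<le> m \<longrightarrow> (y (Suc k) has_real_derivative y k t) (at t)) \<Longrightarrow>
    (\<forall>t. \<bar>y (Suc m) t\<bar> \<le> 2 * A) \<Longrightarrow> (\<forall>s t. \<bar>y 1 s - y 1 t\<bar> \<le> 2 * A * \<bar>s - t\<bar>) \<Longrightarrow> (\<forall>t. \<bar>y m t\<bar> \<le> K)"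
    using Suc.IH[of "2 * A"] by blast
  show ?case
  proof (intro exI[of _ "K + 2 * A"] allI impI)
    fix y :: "nat \<Rightarrow> real \<Rightarrow> real" and t
    assume dy: "\<forall>k t. 1 \<le> k \<longrightarrow> k \<le> Suc m \<longrightarrow> (y (Suc k) has_real_derivative y k t) (at t)"
      and top: "\<forall>t. \<bar>y (Suc (Suc m)) t\<bar> \<le> A" and y1: "\<forall>s t. \<bar>y 1 s - y 1 t\<bar> \<le> A * \<bar>s - t\<bar>"
    have "0 \<le> A" using top[rule_format, of 0] by linarith
    obtain z where z: "t < z" "z < t + 1" "y (Suc (Suc m)) (t + 1) - y (Suc (Suc m)) t = (t + 1 - t) * y (Suc m) z"
      using MVT2[of t "t + 1" "y (Suc (Suc m))" "y (Suc m)"] dy by auto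
    \<comment> \<open>The step \<open>s\<close>, and with it the chain \<open>g\<close>, depends on
      \<open>t\<close>. The induction hypothesis must therefore provide one bound for all
      chains.\<close>
    define s where "s = z - t"
    define g where "g k t = y (Suc k) (t + s) - y (Suc k) t" for k t
    have "\<forall>t. \<bar>g m t\<bar> \<le> K"
    proof (rule K)
      have dg: "(g k has_real_derivative y k (t + s) - y k t) (at t)" if "1 \<le> k" "k \<le> Suc m" for k t
        unfolding g_def using dy that
        by (auto intro!: derivative_eq_intros DERIV_chain2[where f = "y (Suc k)"])
      then show "\<forall>k t. 1 \<le> k \<longrightarrow> k \<le> m \<longrightarrow> (g (Suc k) has_real_derivative g k t) (at t)"
        unfolding g_def[of k for k] by auto
      show "\<forall>t. \<bar>g (Suc m) t\<bar> \<le> 2 * A"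
      proof
        fix t show "\<bar>g (Suc m) t\<bar> \<le> 2 * A"
          using top[rule_format, of "t + s"] top[rule_format, of t] unfolding g_def by linarith
      qed
      show "\<forall>a b. \<bar>g 1 a - g 1 b\<bar> \<le> 2 * A * \<bar>a - b\<bar>"
      proof (intro allI)
        fix a b
        have "norm (g 1 a - g 1 b) \<le> A * norm (a - b)"
        proof (rule field_differentiable_bound[of UNIV])
          show "(g 1 has_field_derivative y 1 (u + s) - y 1 u) (at u within UNIV)" for u
            using dg[of 1] by simp
          show "norm (y 1 (u + s) - y 1 u) \<le> A" for u
          proof -
            have "\<bar>y 1 (u + s) - y 1 u\<bar> \<le> A * \<bar>s\<bar>" using y1[rule_format, of "u + s" u] by simp
            also have "\<dots> \<le> A * 1" using z \<open>0 \<le> A\<close> by (intro mult_left_mono) (auto simp: s_def)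
            finally show ?thesis by simp
          qed
        qed auto
        also have "\<dots> \<le> 2 * A * \<bar>a - b\<bar>" using \<open>0 \<le> A\<close> by (simp add: mult_right_mono)
        finally show "\<bar>g 1 a - g 1 b\<bar> \<le> 2 * A * \<bar>a - b\<bar>" by simp
      qed
    qed
    from this[rule_format, of t] have "\<bar>y (Suc m) z - y (Suc m) t\<bar> \<le> K" by (simp add: g_def s_def)
    moreover have "\<bar>y (Suc m) z\<bar> \<le> 2 * A"
      using z(3) top[rule_format, of t] top[rule_format, of "t + 1"] by simp
    ultimately show "\<bar>y (Suc m) t\<bar> \<le> K + 2 * A" by linarith
  qed
qed

text \<open>This makes the supremum of \<open>\<bar>y k t\<bar>\<close> in
  \<open>comparison_chain\<close> finite; the sharp bound comes out of the comparison itself. In the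
  descent from \<open>r\<close>, the bound just found for \<open>y (Suc k)\<close> is the top of a
  shorter chain.\<close>

lemma derivatives_bounded:
  fixes y :: "nat \<Rightarrow> real \<Rightarrow> real"
  assumes dy: "\<And>k t. 1 \<le> k \<Longrightarrow> k < r \<Longrightarrow> (y (Suc k) has_real_derivative y k t) (at t)"
    and top: "\<And>t. \<bar>y r t\<bar> \<le> A" and lip: "\<And>s t. \<bar>y 1 s - y 1 t\<bar> \<le> L * \<bar>s - t\<bar>"
    and k: "1 \<le> k" "k \<le> r"
  shows "\<exists>K. \<forall>t. \<bar>y k t\<bar> \<le> K"
  using k(2,1)
proof (induction k rule: inc_induct)
  case base
  then show ?case using top by blast
next
  case (step k)
  then obtain B where B: "\<And>t. \<bar>y (Suc k) t\<bar> \<le> B" by auto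
  obtain K where "\<forall>y :: nat \<Rightarrow> real \<Rightarrow> real.
    (\<forall>j t. 1 \<le> j \<longrightarrow> j \<le> k \<longrightarrow> (y (Suc j) has_real_derivative y j t) (at t)) \<longrightarrow>
    (\<forall>t. \<bar>y (Suc k) t\<bar> \<le> max B L) \<longrightarrow> (\<forall>s t. \<bar>y 1 s - y 1 t\<bar> \<le> max B L * \<bar>s - t\<bar>) \<longrightarrow> (\<forall>t. \<bar>y k t\<bar> \<le> K)"
    using penultimate_derivative_bounded[OF \<open>1 \<le> k\<close>, of "max B L"] by blast
  moreover have "\<forall>j t. 1 \<le> j \<longrightarrow> j \<le> k \<longrightarrow> (y (Suc j) has_real_derivative y j t) (at t)"
    using dy step by simp
  moreover have "\<forall>t. \<bar>y (Suc k) t\<bar> \<le> max B L" using B by (simp add: le_max_iff_disj)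
  moreover have "\<bar>y 1 s - y 1 t\<bar> \<le> max B L * \<bar>s - t\<bar>" for s t
    using lip[of s t] mult_right_mono[of L "max B L" "\<bar>s - t\<bar>"] by simp
  ultimately show ?case by blast
qed

section \<open>The functions \<open>\<psi>\<close>\<close>

context
  fixes f :: "real \<Rightarrow> real"
  assumes cont: "continuous_on UNIV f"
begin

lemma integral_from_0_deriv:
  "((\<lambda>t. LBINT s=0..t. f s) has_real_derivative f t) (at t)"
proof -
  define a b where "a = min 0 (t - 1)" and "b = max 0 (t + 1)"
  have "((\<lambda>u. LBINT s=ereal 0..ereal u. f s) has_vector_derivative f t) (at t within {a..b})"
    by (rule interval_integral_FTC2) (use cont in \<open>auto simp: a_def b_def intro: continuous_on_subset\<close>)
  moreover have "at t within {a..b} = at t"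
    by (rule at_within_Icc_at) (auto simp: a_def b_def)
  ultimately show ?thesis
    by (simp add: zero_ereal_def has_real_derivative_iff_has_vector_derivative)
qed

lemma zero_mean_integral_deriv:
  "(zero_mean_integral P f has_real_derivative f t) (at t)"
proof -
  have "((\<lambda>t. (LBINT s=0..t. f s) - (1 / P) * (LBINT u=0..P. (LBINT s=0..u. f s))) has_real_derivative f t - 0) (at t)"
    by (intro DERIV_diff integral_from_0_deriv DERIV_const)
  then show ?thesis by (simp add: zero_mean_integral_def[abs_def])
qed

end

text \<open>The antiderivative \<open>G\<close> from 0 satisfies \<open>G (t + T) + G t = L\<close>
  for a constant \<open>L\<close>. Integrating this identity once more shows that the mean of
  \<open>G\<close> over a period is \<open>L / 2\<close>, so subtracting the mean removes exactly
  the obstruction to antiperiodicity.\<close>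

lemma zero_mean_integral_antiperiodic:
  fixes f :: "real \<Rightarrow> real"
  assumes cont: "continuous_on UNIV f" and anti: "\<And>t. f (t + T) = - f t" and "0 < T"
  shows "zero_mean_integral (2 * T) f (t + T) = - zero_mean_integral (2 * T) f t"
proof -
  define G where "G t = (LBINT s=0..t. f s)" for t :: real
  define H where "H t = (LBINT s=0..t. G s)" for t :: real
  have dG: "(G has_real_derivative f t) (at t)" for t
    unfolding G_def[abs_def] by (rule integral_from_0_deriv[OF cont])
  have "continuous_on UNIV G"
    by (rule DERIV_continuous_on[where D = f]) (simp add: dG)
  then have dH: "(H has_real_derivative G t) (at t)" for t
    unfolding H_def[abs_def] by (rule integral_from_0_deriv)
  have "((\<lambda>t. G (t + T) + G t) has_real_derivative 0) (at t)" for t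
    using anti[of t] by (auto intro!: derivative_eq_intros DERIV_chain2[OF dG])
  then have "G (t + T) + G t = G (0 + T) + G 0" for t
    by (rule DERIV_isconst_all[rule_format])
  then obtain L where L: "\<And>t. G (t + T) + G t = L" by blast
  have "((\<lambda>t. H (t + T) + H t - L * t) has_real_derivative 0) (at t)" for t
    using L[of t] by (auto intro!: derivative_eq_intros DERIV_chain2[OF dH])
  then have "H (T + T) + H T - L * T = H (0 + T) + H 0 - L * 0"
    by (rule DERIV_isconst_all[rule_format])
  moreover have "H 0 = 0" by (simp add: H_def flip: zero_ereal_def)
  ultimately have "H (2 * T) = L * T" by simp
  then have "1 / (2 * T) * H (2 * T) = L / 2" using \<open>0 < T\<close> by simp
  then show ?thesis
    using L[of t] unfolding zero_mean_integral_def G_def[symmetric] H_def[symmetric] by simp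
qed

lemma psi_1: "psi 1 a1 a2 = psi1 a1 a2"
  by (simp add: psi_def)

lemma psi_Suc: "1 \<le> k \<Longrightarrow> psi (Suc k) a1 a2 = zero_mean_integral (2 * (a1 + a2 + 2)) (psi k a1 a2)"
  by (cases k) (simp_all add: psi_def)

text \<open>This and the next three definitions supply the parameters of \<open>psi k\<close> in
  \<open>hump\<close>. For \<open>k = 1\<close> they are read off the trapezoid over
  \<open>{a1..a1 + a2 + 2}\<close>. Afterwards they follow \<open>hump_integral\<close>: the centre
  moves by half of \<open>a1 + a2 + 2\<close>, the old half-width becomes the rise, and the maximum
  is attained at the old right end.\<close>

definition psi_center :: "real \<Rightarrow> real \<Rightarrow> nat \<Rightarrow> real" where
  "psi_center a1 a2 k = a1 + 1 + a2 / 2 + real (k - 1) * ((a1 + a2 + 2) / 2)"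

definition psi_width :: "real \<Rightarrow> real \<Rightarrow> nat \<Rightarrow> real" where
  "psi_width a1 a2 k = (if k = 1 then 1 + a2 / 2 else (a1 + a2 + 2) / 2)"

definition psi_rise :: "real \<Rightarrow> real \<Rightarrow> nat \<Rightarrow> real" where
  "psi_rise a1 a2 k = (if k = 1 then 1 else psi_width a1 a2 (k - 1))"

definition psi_max :: "real \<Rightarrow> real \<Rightarrow> nat \<Rightarrow> real" where
  "psi_max a1 a2 k = (if k = 1 then 1 else psi k a1 a2 (psi_center a1 a2 (k - 1) + psi_width a1 a2 (k - 1)))"

section \<open>The waves \<open>psi k\<close> as half-waves in the sense of
  \<open>hump\<close>\<close>

context
  fixes a1 a2 :: real
  assumes a: "0 \<le> a1" "0 \<le> a2"
begin

lemma psi1_eq: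
  assumes "0 \<le> t" "t \<le> a1 + a2 + 2" shows "psi1 a1 a2 t = psi1_base a1 a2 t"
  using assms a by (simp add: psi1_def Let_def)

lemma psi1_antiperiodic: "psi1 a1 a2 (t + (a1 + a2 + 2)) = - psi1 a1 a2 t"
proof -
  define T where "T = a1 + a2 + 2"
  define s where "s = t rmod (2 * T)"
  have "0 < T" using a by (simp add: T_def)
  then have s: "0 \<le> s" "s < 2 * T" unfolding s_def by (auto intro: rmod_nonneg rmod_less)
  have t: "t = s + of_int \<lfloor>t / (2 * T)\<rfloor> * (2 * T)"
    using \<open>0 < T\<close> by (simp add: s_def rmod_def)
  \<comment> \<open>The two branches of \<open>psi1\<close> meet at multiples of \<open>T\<close>.
    There both values are 0, so it does not matter on which side the definition places such a
    point.\<close>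
  have ends: "psi1_base a1 a2 0 = 0" "psi1_base a1 a2 T = 0"
    using a by (auto simp: psi1_base_def T_def)
  show ?thesis
  proof (cases "s < T")
    case True
    have "(t + T) rmod (2 * T) = s + T"
      by (rule rmod_unique[of _ _ _ "\<lfloor>t / (2 * T)\<rfloor>"]) (use True s t in auto)
    then have "psi1 a1 a2 (t + T) = (if s + T \<le> T then psi1_base a1 a2 (s + T) else - psi1_base a1 a2 s)"
      "psi1 a1 a2 t = psi1_base a1 a2 s"
      using True s unfolding psi1_def T_def[symmetric] s_def[symmetric] Let_def by auto
    then show ?thesis using ends s by (cases "s = 0") (auto simp: T_def[symmetric])
  next
    case False
    have "(t + T) rmod (2 * T) = s - T"
      by (rule rmod_unique[of _ _ _ "\<lfloor>t / (2 * T)\<rfloor> + 1"]) (use False s t in \<open>auto simp: algebra_simps\<close>)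
    then have "psi1 a1 a2 (t + T) = psi1_base a1 a2 (s - T)"
      "psi1 a1 a2 t = (if s \<le> T then psi1_base a1 a2 s else - psi1_base a1 a2 (s - T))"
      using False s unfolding psi1_def T_def[symmetric] s_def[symmetric] Let_def by auto
    then show ?thesis using ends False by (cases "s = T") (auto simp: T_def[symmetric])
  qed
qed

lemma psi1_isCont: "isCont (psi1 a1 a2) t"
proof -
  define T where "T = a1 + a2 + 2"
  have "0 < T" using a by (simp add: T_def)
  have anti: "psi1 a1 a2 (t + T) = - psi1 a1 a2 t" for t
    using psi1_antiperiodic by (simp add: T_def)
  obtain u \<sigma> k where \<sigma>: "\<sigma> \<in> {1, -1}" and u: "0 \<le> u" "u < 0 + T"
    and shift: "\<And>v. psi1 a1 a2 (v + of_int k * T) = \<sigma> * psi1 a1 a2 v" and t: "t = u + of_int k * T"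
    by (rule antiperiodic_reduce[of "psi1 a1 a2" T 0 t, OF anti \<open>0 < T\<close>]) (rule that)
  \<comment> \<open>A clamped formula, continuous by construction and valid on both sides of 0, so
    that the joint \<open>u = 0\<close> is an interior point of its range of validity.\<close>
  define g where "g t = max 0 (min (t - a1) (min 1 (T - t))) - max 0 (min (t + T - a1) (min 1 (- t)))" for t
  have base: "psi1_base a1 a2 v = max 0 (min (v - a1) (min 1 (T - v)))" if "0 \<le> v" "v \<le> T" for v
    using that a by (simp add: psi1_base_def T_def max_def min_def)
  have g: "psi1 a1 a2 v = g v" if "v \<in> {- T<..<T}" for v
  proof (cases "0 \<le> v")
    case True
    then have "psi1 a1 a2 v = max 0 (min (v - a1) (min 1 (T - v)))"
      using psi1_eq[of v] base[of v] that by (simp add: T_def)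
    then show ?thesis using True by (simp add: g_def)
  next
    case False
    then have "psi1 a1 a2 v = - max 0 (min (v + T - a1) (min 1 (T - (v + T))))"
      using psi1_eq[of "v + T"] anti[of v] base[of "v + T"] that by (simp add: T_def)
    then show ?thesis using False a by (simp add: g_def)
  qed
  have "isCont g u" unfolding g_def by (intro continuous_intros)
  moreover have "\<forall>\<^sub>F v in nhds u. psi1 a1 a2 v = g v"
    using eventually_nhds_in_open[of "{- T<..<T}" u] u \<open>0 < T\<close> g by (auto elim!: eventually_mono)
  ultimately have "isCont (psi1 a1 a2) u" by (simp add: isCont_cong)
  moreover have eq: "(\<lambda>v. \<sigma> * psi1 a1 a2 (v - of_int k * T)) = psi1 a1 a2"
    by (rule ext, rule trans[OF shift[symmetric]]) simp
  ultimately have "isCont (\<lambda>t. \<sigma> * psi1 a1 a2 (t - of_int k * T)) t"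
    unfolding t by (intro continuous_intros continuous_at_compose[of _ "\<lambda>t. t - of_int k * T", unfolded o_def]) auto
  then show ?thesis unfolding eq .
qed

lemma psi1_hump: "hump (psi1 a1 a2) (a1 + 1 + a2 / 2) (1 + a2 / 2) 1 1 (a1 + a2 + 2)"
  unfolding hump_def
proof (intro conjI allI ballI)
  define T where "T = a1 + a2 + 2"
  have "0 < T" using a by (simp add: T_def)
  have anti: "psi1 a1 a2 (t + T) = - psi1 a1 a2 t" for t
    using psi1_antiperiodic by (simp add: T_def)
  show "continuous_on UNIV (psi1 a1 a2)"
    by (simp add: continuous_at_imp_continuous_on psi1_isCont)
  show "psi1 a1 a2 (t + (a1 + a2 + 2)) = - psi1 a1 a2 t" for t
    by (rule psi1_antiperiodic)
  show "psi1 a1 a2 (2 * (a1 + 1 + a2 / 2) - t) = psi1 a1 a2 t" for t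
  proof -
    obtain u \<sigma> k where \<sigma>: "\<sigma> \<in> {1, -1}" and u: "0 \<le> u" "u < 0 + T"
      and shift: "\<And>v. psi1 a1 a2 (v + of_int k * T) = \<sigma> * psi1 a1 a2 v" and t: "t = u + of_int k * T"
      by (rule antiperiodic_reduce[of "psi1 a1 a2" T 0 t, OF anti \<open>0 < T\<close>]) (rule that)
    \<comment> \<open>Reflection in the centre is \<open>t \<mapsto> a1 + T - t\<close>. For
      \<open>u < a1\<close> it leaves the half period, but the image is the translate of
      \<open>a1 - u\<close>, and both \<open>u\<close> and \<open>a1 - u\<close> lie where
      \<open>psi1\<close> vanishes.\<close>
    have eq: "psi1 a1 a2 (a1 + T - u) = psi1 a1 a2 u"
    proof (cases "a1 \<le> u")
      case True
      then show ?thesis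
        using psi1_eq[of u] psi1_eq[of "a1 + T - u"] u a by (auto simp: psi1_base_def T_def)
    next
      case False
      then show ?thesis
        using psi1_eq[of u] psi1_eq[of "a1 - u"] anti[of "a1 - u"] u a
        by (auto simp: psi1_base_def T_def algebra_simps)
    qed
    have "a1 + T - u = (a1 + T - t) + of_int k * T" by (simp add: t)
    then have "psi1 a1 a2 (a1 + T - u) = \<sigma> * psi1 a1 a2 (a1 + T - t)"
      using shift[of "a1 + T - t"] by (simp only:)
    moreover have "psi1 a1 a2 t = \<sigma> * psi1 a1 a2 u" using shift[of u] by (simp add: t)
    ultimately have "psi1 a1 a2 (a1 + T - t) = psi1 a1 a2 t" using eq \<sigma> by auto
    moreover have "2 * (a1 + 1 + a2 / 2) - t = a1 + T - t" by (simp add: T_def)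
    ultimately show ?thesis by (simp only:)
  qed
  show "strict_mono_on {a1 + 1 + a2 / 2 - (1 + a2 / 2)..a1 + 1 + a2 / 2 - (1 + a2 / 2) + 1} (psi1 a1 a2)"
    using a by (auto simp: strict_mono_on_def psi1_eq psi1_base_def)
  show "psi1 a1 a2 t = 0"
    if "t \<in> {a1 + 1 + a2 / 2 + (1 + a2 / 2)..a1 + 1 + a2 / 2 + (a1 + a2 + 2) / 2}" for t
    using anti[of "t - T"] psi1_eq[of "t - T"] that a by (auto simp: psi1_base_def T_def field_simps)
qed (use a in \<open>auto simp: psi1_eq psi1_base_def field_simps\<close>)

lemma psi_hump:
  assumes "1 \<le> k"
  shows "hump (psi k a1 a2) (psi_center a1 a2 k) (psi_width a1 a2 k) (psi_rise a1 a2 k) (psi_max a1 a2 k) (a1 + a2 + 2)"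
  using assms
proof (induction k rule: nat_induct_at_least)
  case base
  show ?case
    using psi1_hump unfolding psi_1 by (simp add: psi_center_def psi_width_def psi_rise_def psi_max_def)
next
  case (Suc k)
  note c = hump_continuous[OF Suc.IH] and anti = hump_antiperiodic(1)[OF Suc.IH] and T = hump_dims(5)[OF Suc.IH]
  have "hump (psi (Suc k) a1 a2) (psi_center a1 a2 k + (a1 + a2 + 2) / 2) ((a1 + a2 + 2) / 2) (psi_width a1 a2 k)
      (psi (Suc k) a1 a2 (psi_center a1 a2 k + psi_width a1 a2 k)) (a1 + a2 + 2)"
  proof (rule hump_integral[OF Suc.IH])
    show "(psi (Suc k) a1 a2 has_real_derivative psi k a1 a2 t) (at t)" for t
      unfolding psi_Suc[OF Suc.hyps] by (rule zero_mean_integral_deriv[OF c])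
    show "psi (Suc k) a1 a2 (t + (a1 + a2 + 2)) = - psi (Suc k) a1 a2 t" for t
      unfolding psi_Suc[OF Suc.hyps] by (rule zero_mean_integral_antiperiodic[OF c anti T])
  qed
  moreover have "psi_center a1 a2 (Suc k) = psi_center a1 a2 k + (a1 + a2 + 2) / 2"
    using Suc.hyps by (cases k) (auto simp: psi_center_def field_simps)
  ultimately show ?case
    using Suc.hyps by (simp add: psi_width_def psi_rise_def psi_max_def)
qed

lemma psi_deriv:
  assumes "1 \<le> k" shows "(psi (Suc k) a1 a2 has_real_derivative psi k a1 a2 t) (at t)"
  unfolding psi_Suc[OF assms]
  by (rule zero_mean_integral_deriv) (rule hump_continuous[OF psi_hump[OF assms]])

lemma psi1_piecewise_linear:
  obtains N where "countable N"
    "\<And>t. t \<notin> N \<Longrightarrow> \<exists>D. \<bar>D\<bar> \<le> 1 \<and> (psi1 a1 a2 has_real_derivative D) (at t)"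
proof -
  define T where "T = a1 + a2 + 2"
  have "0 < T" using a by (simp add: T_def)
  have anti: "psi1 a1 a2 (t + T) = - psi1 a1 a2 t" for t
    using psi1_antiperiodic by (simp add: T_def)
  define N where "N = (\<lambda>(u, k :: int). u + of_int k * T) ` ({0, a1, a1 + 1, a1 + a2 + 1} \<times> UNIV)"
  have "countable N" unfolding N_def by (intro countable_image countable_SIGMA) auto
  moreover have "\<exists>D. \<bar>D\<bar> \<le> 1 \<and> (psi1 a1 a2 has_real_derivative D) (at t)" if t: "t \<notin> N" for t
  proof -
    obtain u \<sigma> k where \<sigma>: "\<sigma> \<in> {1, -1}" and u: "0 \<le> u" "u < 0 + T"
      and shift: "\<And>v. psi1 a1 a2 (v + of_int k * T) = \<sigma> * psi1 a1 a2 v" and tu: "t = u + of_int k * T"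
      by (rule antiperiodic_reduce[of "psi1 a1 a2" T 0 t, OF anti \<open>0 < T\<close>]) (rule that)
    have "u \<notin> {0, a1, a1 + 1, a1 + a2 + 1}"
    proof
      assume "u \<in> {0, a1, a1 + 1, a1 + a2 + 1}"
      then have "(u, k) \<in> {0, a1, a1 + 1, a1 + a2 + 1} \<times> UNIV" by simp
      then have "(\<lambda>(u, k :: int). u + of_int k * T) (u, k) \<in> N" unfolding N_def by (rule imageI)
      then show False using t tu by simp
    qed
    then have u': "u \<noteq> 0" "u \<noteq> a1" "u \<noteq> a1 + 1" "u \<noteq> a1 + a2 + 1" by auto
    have piece: "(psi1 a1 a2 has_real_derivative D) (at u)"
      if "l < u" "u < r" "0 \<le> l" "r \<le> T" "\<And>v. l < v \<Longrightarrow> v < r \<Longrightarrow> psi1_base a1 a2 v = c + D * v" for l r c D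
    proof -
      have "((\<lambda>v. c + D * v) has_real_derivative D) (at u)" by (auto intro!: derivative_eq_intros)
      then show ?thesis
      proof (rule DERIV_cong_ev[THEN iffD2, rotated -1])
        show "\<forall>\<^sub>F v in nhds u. psi1 a1 a2 v = c + D * v"
          using eventually_nhds_in_open[of "{l<..<r}" u] that psi1_eq
          by (auto simp: T_def elim!: eventually_mono)
      qed auto
    qed
    consider "u < a1" | "a1 < u" "u < a1 + 1" | "a1 + 1 < u" "u < a1 + a2 + 1" | "a1 + a2 + 1 < u"
      using u' by linarith
    then have "\<exists>D. \<bar>D\<bar> \<le> 1 \<and> (psi1 a1 a2 has_real_derivative D) (at u)"
    proof cases
      case 1
      have "(psi1 a1 a2 has_real_derivative 0) (at u)"
        by (rule piece[of 0 a1 0]) (use 1 u u' a in \<open>auto simp: psi1_base_def T_def\<close>)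
      then show ?thesis by (intro exI[of _ 0]) auto
    next
      case 2
      have "(psi1 a1 a2 has_real_derivative 1) (at u)"
        by (rule piece[of a1 "a1 + 1" "- a1"]) (use 2 u u' a in \<open>auto simp: psi1_base_def T_def\<close>)
      then show ?thesis by (intro exI[of _ 1]) auto
    next
      case 3
      have "(psi1 a1 a2 has_real_derivative 0) (at u)"
        by (rule piece[of "a1 + 1" "a1 + a2 + 1" 1]) (use 3 u u' a in \<open>auto simp: psi1_base_def T_def\<close>)
      then show ?thesis by (intro exI[of _ 0]) auto
    next
      case 4
      have "(psi1 a1 a2 has_real_derivative -1) (at u)"
        by (rule piece[of "a1 + a2 + 1" T T]) (use 4 u u' a in \<open>auto simp: psi1_base_def T_def\<close>)
      then show ?thesis by (intro exI[of _ "-1"]) auto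
    qed
    then obtain D where D: "\<bar>D\<bar> \<le> 1" "(psi1 a1 a2 has_real_derivative D) (at u)" by blast
    have "((\<lambda>t. \<sigma> * psi1 a1 a2 (t - of_int k * T)) has_real_derivative \<sigma> * D) (at t)"
      by (auto intro!: derivative_eq_intros DERIV_chain2[where f = "psi1 a1 a2" and Da = D] simp: tu D(2))
    moreover have "(\<lambda>v. \<sigma> * psi1 a1 a2 (v - of_int k * T)) = psi1 a1 a2"
      by (rule ext, rule trans[OF shift[symmetric]]) simp
    ultimately have "(psi1 a1 a2 has_real_derivative \<sigma> * D) (at t)" by simp
    moreover have "\<bar>\<sigma> * D\<bar> \<le> 1" using \<sigma> D(1) by (auto simp: abs_mult)
    ultimately show ?thesis by blast
  qed
  ultimately show thesis using that by blast
qed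

end

section \<open>Essential suprema\<close>

lemma Linf_norm_leI:
  assumes "f \<in> borel_measurable lebesgue" "AE t in lebesgue. \<bar>f t\<bar> \<le> B"
  shows "Linf_norm f \<le> ereal B"
  unfolding Linf_norm_def
proof (rule esssup_I)
  show "(\<lambda>t. ereal \<bar>f t\<bar>) \<in> borel_measurable lebesgue" using assms(1) by measurable
  show "AE t in lebesgue. ereal \<bar>f t\<bar> \<le> ereal B" using assms(2) by simp
qed

lemma negligible_Linf_norm_exceeding:
  assumes "Linf_norm f \<le> ereal B"
  shows "negligible {t. \<not> \<bar>f t\<bar> \<le> B}"
proof -
  have "AE t in lebesgue. ereal \<bar>f t\<bar> \<le> Linf_norm f"
    unfolding Linf_norm_def by (rule esssup_AE)
  then have "AE t in lebesgue. \<bar>f t\<bar> \<le> B"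
  proof (rule eventually_mono)
    fix t assume "ereal \<bar>f t\<bar> \<le> Linf_norm f"
    then have "ereal \<bar>f t\<bar> \<le> ereal B" using assms by (rule order_trans)
    then show "\<bar>f t\<bar> \<le> B" by simp
  qed
  then obtain N where "{t \<in> space lebesgue. \<not> \<bar>f t\<bar> \<le> B} \<subseteq> N" "N \<in> null_sets lebesgue"
    by (auto simp: eventually_ae_filter)
  then show ?thesis
    by (auto simp: negligible_iff_null_sets[symmetric] intro: negligible_subset)
qed

text \<open>The points where the bound fails form an open null set.\<close>

lemma Linf_norm_leD:
  assumes "continuous_on UNIV f" "Linf_norm f \<le> ereal B"
  shows "\<bar>f t\<bar> \<le> B"
proof (rule ccontr)
  assume "\<not> ?thesis"
  then have "t \<in> {t. \<not> \<bar>f t\<bar> \<le> B}" by simp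
  moreover have "open {t. \<not> \<bar>f t\<bar> \<le> B}"
    unfolding not_le by (intro open_Collect_less continuous_intros assms(1))
  ultimately show False
    using negligible_Linf_norm_exceeding[OF assms(2)] open_not_negligible by blast
qed

lemma Linf_norm_continuous_le:
  assumes "continuous_on UNIV f" "\<And>t. \<bar>f t\<bar> \<le> B"
  shows "Linf_norm f \<le> ereal B"
  using assms by (intro Linf_norm_leI AE_I2 measurable_completion) (auto intro: borel_measurable_continuous_onI)

text \<open>\<open>esssup\<close> takes the value \<open>top\<close> on functions that are not
  measurable, so a finite bound requires measurability of \<open>deriv f\<close>. Outside the
  countable set \<open>N\<close> it is the limit of the continuous difference quotients with steps
  \<open>1 / real (Suc n)\<close>.\<close>

lemma Linf_norm_deriv_le:
  fixes f :: "real \<Rightarrow> real"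
  assumes cont: "continuous_on UNIV f" and "countable N"
    and D: "\<And>t. t \<notin> N \<Longrightarrow> \<exists>D. \<bar>D\<bar> \<le> B \<and> (f has_real_derivative D) (at t)"
  shows "Linf_norm (deriv f) \<le> ereal B"
proof (rule Linf_norm_leI)
  define g where "g t = lim (\<lambda>n. (f (t + 1 / real (Suc n)) - f t) / (1 / real (Suc n)))" for t
  have "g \<in> borel_measurable lborel"
    unfolding g_def
  proof (rule borel_measurable_lim_metric)
    fix n
    have "continuous_on UNIV (\<lambda>t. (f (t + 1 / real (Suc n)) - f t) / (1 / real (Suc n)))"
      by (intro continuous_intros continuous_on_compose2[OF cont] cont) auto
    then show "(\<lambda>t. (f (t + 1 / real (Suc n)) - f t) / (1 / real (Suc n))) \<in> borel_measurable lborel"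
      by (simp add: borel_measurable_continuous_onI)
  qed
  then have g: "g \<in> borel_measurable lebesgue" by (rule measurable_completion)
  have eq: "deriv f t = g t" if "t \<notin> N" for t
  proof -
    obtain D where "(f has_real_derivative D) (at t)" using D[OF \<open>t \<notin> N\<close>] by blast
    then have "((\<lambda>h. (f (t + h) - f t) / h) \<longlongrightarrow> D) (at 0)" by (simp add: DERIV_def)
    moreover have "filterlim (\<lambda>n. 1 / real (Suc n)) (at 0) sequentially"
      unfolding filterlim_at using LIMSEQ_inverse_real_of_nat by (auto simp: inverse_eq_divide)
    ultimately have "(\<lambda>n. (f (t + 1 / real (Suc n)) - f t) / (1 / real (Suc n))) \<longlonglongrightarrow> D"
      by (rule filterlim_compose)
    then have "g t = D" unfolding g_def by (rule limI)
    then show ?thesis using \<open>(f has_real_derivative D) (at t)\<close> by (simp add: DERIV_imp_deriv)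
  qed
  show "deriv f \<in> borel_measurable lebesgue"
    by (rule measurable_discrete_difference[OF g \<open>countable N\<close>]) (use eq in auto)
  have "N \<in> null_sets lebesgue"
    using \<open>countable N\<close> by (simp add: countable_imp_null_set_lborel null_sets_completionI)
  then show "AE t in lebesgue. \<bar>deriv f t\<bar> \<le> B"
  proof (rule AE_I', intro subsetI)
    fix t assume t: "t \<in> {t \<in> space lebesgue. \<not> \<bar>deriv f t\<bar> \<le> B}"
    show "t \<in> N"
    proof (rule ccontr)
      assume "t \<notin> N"
      then obtain D where "\<bar>D\<bar> \<le> B" "(f has_real_derivative D) (at t)" using D by blast
      then show False using t by (simp add: DERIV_imp_deriv)
    qed
  qed
qed

lemma locally_abs_continuous_imp_continuous:
  assumes "locally_abs_continuous f" shows "continuous_on UNIV f"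
proof (rule continuous_at_imp_continuous_on, intro ballI)
  fix t
  have ac: "abs_continuous_on_interval (t - 1) (t + 1) f"
    using assms by (simp add: locally_abs_continuous_def)
  show "isCont f t"
    unfolding continuous_at_eps_delta
  proof (intro allI impI)
    fix e :: real assume "e > 0"
    obtain d where "d > 0" and d: "\<And>I. finite I \<Longrightarrow> (\<forall>p\<in>I. t - 1 \<le> fst p \<and> fst p \<le> snd p \<and> snd p \<le> t + 1) \<Longrightarrow>
      (\<forall>p\<in>I. \<forall>q\<in>I. p \<noteq> q \<longrightarrow> {fst p<..<snd p} \<inter> {fst q<..<snd q} = {}) \<Longrightarrow>
      (\<Sum>p\<in>I. snd p - fst p) < d \<Longrightarrow> (\<Sum>p\<in>I. \<bar>f (snd p) - f (fst p)\<bar>) < e"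
      by (rule abs_continuous_onE[OF ac \<open>e > 0\<close>]) blast
    have "\<bar>f s - f t\<bar> < e" if "\<bar>s - t\<bar> < min 1 d" for s
      using d[of "{(s, t)}"] d[of "{(t, s)}"] that by (cases "s \<le> t") (simp_all add: abs_minus_commute)
    then show "\<exists>d>0. \<forall>x'. dist x' t < d \<longrightarrow> dist (f x') (f t) < e"
      using \<open>d > 0\<close> by (intro exI[of _ "min 1 d"]) (auto simp: dist_real_def)
  qed
qed

lemma locally_abs_continuous_lipschitz:
  assumes "locally_abs_continuous f" "Linf_norm (deriv f) \<le> ereal B"
  shows "\<bar>f s - f t\<bar> \<le> B * \<bar>s - t\<bar>"
proof -
  have le: "\<bar>f d - f c\<bar> \<le> B * (d - c)" if "c \<le> d" for c d
    by (rule abs_continuous_increment_le[OF _ that negligible_Linf_norm_exceeding[OF assms(2)]])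
      (use assms(1) that in \<open>simp add: locally_abs_continuous_def\<close>)
  show ?thesis
    using le[of s t] le[of t s] by (cases "s \<le> t") (auto simp: abs_minus_commute)
qed

section \<open>The comparison theorem\<close>

context
  fixes a1 a2 l b \<omega> :: real
  assumes a: "0 \<le> a1" "0 \<le> a2" and l: "0 < l"
  defines "\<omega> \<equiv> (2 * a1 + 2 * a2 + 4) / l"
begin

lemma freq_pos: "0 < \<omega>"
  using a l by (simp add: \<omega>_def)

lemma Psi_eq: "Psi r a1 a2 b l = (\<lambda>t. b / \<omega> ^ r * psi r a1 a2 (\<omega> * t))"
  using a l by (simp add: Psi_def[abs_def] \<omega>_def power_divide)

lemma Psi_deriv:
  assumes "1 \<le> k"
  shows "(Psi (Suc k) a1 a2 b l has_real_derivative Psi k a1 a2 b l t) (at t)"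
proof -
  have "(Psi (Suc k) a1 a2 b l has_real_derivative b / \<omega> ^ Suc k * (psi k a1 a2 (\<omega> * t) * \<omega>)) (at t)"
    unfolding Psi_eq
    by (auto intro!: derivative_eq_intros DERIV_chain2[OF psi_deriv[OF a assms]])
  then show ?thesis using freq_pos by (simp add: Psi_eq)
qed

lemma Psi_higher_deriv:
  "k < r \<Longrightarrow> (deriv ^^ k) (Psi r a1 a2 b l) = Psi (r - k) a1 a2 b l"
proof (induction k)
  case (Suc k)
  have "deriv (Psi (r - k) a1 a2 b l) = Psi (r - Suc k) a1 a2 b l"
    using Psi_deriv[of "r - Suc k"] Suc.prems by (auto intro!: ext DERIV_imp_deriv simp: Suc_diff_Suc)
  then show ?case using Suc by simp
qed simp

lemma Psi_norm_le:
  assumes "1 \<le> k" shows "Linf_norm (Psi k a1 a2 b l) \<le> ereal (\<bar>b\<bar> / \<omega> ^ k * psi_max a1 a2 k)"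
proof (rule Linf_norm_continuous_le)
  note h = psi_hump[OF a assms]
  show "continuous_on UNIV (Psi k a1 a2 b l)"
    unfolding Psi_eq by (intro continuous_intros continuous_on_compose2[OF hump_continuous[OF h, of UNIV]]) auto
  show "\<bar>Psi k a1 a2 b l t\<bar> \<le> \<bar>b\<bar> / \<omega> ^ k * psi_max a1 a2 k" for t
    using mult_left_mono[OF hump_abs_le[OF h, of "\<omega> * t"], of "\<bar>b\<bar> / \<omega> ^ k"] freq_pos
    unfolding Psi_eq by (simp add: abs_mult)
qed

text \<open>\<open>psi1\<close> has slopes 0, 1 and -1 away from countably many corners, and the
  chain rule factor \<open>\<omega>\<close> cancels the scaling factor \<open>1 / \<omega>\<close>.
  At the corners \<open>deriv\<close> is unspecified.\<close>

lemma Psi_top_norm_le: "Linf_norm (deriv (Psi 1 a1 a2 b l)) \<le> ereal \<bar>b\<bar>"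
proof -
  obtain N where N: "countable N"
    "\<And>t. t \<notin> N \<Longrightarrow> \<exists>D. \<bar>D\<bar> \<le> 1 \<and> (psi1 a1 a2 has_real_derivative D) (at t)"
    by (rule psi1_piecewise_linear[OF a]) blast
  show ?thesis
  proof (rule Linf_norm_deriv_le)
    show "continuous_on UNIV (Psi 1 a1 a2 b l)"
      unfolding Psi_eq by (intro continuous_intros continuous_on_compose2[OF hump_continuous[OF psi_hump[OF a], of 1 UNIV]]) auto
    show "countable ((\<lambda>t. t / \<omega>) ` N)" using N(1) by simp
    fix t assume t: "t \<notin> (\<lambda>t. t / \<omega>) ` N"
    have "\<omega> * t \<notin> N"
    proof
      assume "\<omega> * t \<in> N"
      then have "\<omega> * t / \<omega> \<in> (\<lambda>t. t / \<omega>) ` N" by (rule imageI)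
      then show False using t freq_pos by simp
    qed
    then obtain D where D: "\<bar>D\<bar> \<le> 1" "(psi1 a1 a2 has_real_derivative D) (at (\<omega> * t))" using N(2) by blast
    have "(Psi 1 a1 a2 b l has_real_derivative b / \<omega> ^ 1 * (D * \<omega>)) (at t)"
      unfolding Psi_eq psi_1
      by (auto intro!: derivative_eq_intros DERIV_chain2[where f = "psi1 a1 a2" and Da = D] simp: D(2))
    moreover have "b / \<omega> ^ 1 * (D * \<omega>) = b * D" using freq_pos by simp
    moreover have "\<bar>b * D\<bar> \<le> \<bar>b\<bar>" using D(1) by (simp add: abs_mult mult_left_le)
    ultimately show "\<exists>D. \<bar>D\<bar> \<le> \<bar>b\<bar> \<and> (Psi 1 a1 a2 b l has_real_derivative D) (at t)" by metis
  qed
qed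

end

lemma DERIV_affine_argument:
  fixes f :: "real \<Rightarrow> real"
  assumes "(f has_real_derivative D) (at ((t - n) / m))" "m \<noteq> 0"
  shows "((\<lambda>t. k * f ((t - n) / m)) has_real_derivative k * (D * (1 / m))) (at t)"
proof (rule DERIV_cmult, rule DERIV_chain2[where f = f and g = "\<lambda>t. (t - n) / m" and x = t, OF assms(1)])
  show "((\<lambda>t. (t - n) / m) has_real_derivative 1 / m) (at t)"
    using assms(2) by (auto intro!: derivative_eq_intros)
qed

text \<open>Going back by \<open>s\<close> on the rising branch lowers \<open>c * psi1\<close> by
  \<open>c * s \<ge> s\<close>, and a function with Lipschitz constant 1 changes by at most
  \<open>s\<close>.\<close>

lemma psi1_dominated:
  assumes a: "0 \<le> a1" "0 \<le> a2" and lip: "\<And>s t. \<bar>y s - y t\<bar> \<le> \<bar>s - t\<bar>" and "1 \<le> c"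
    and lin: "\<And>t. \<alpha> \<le> t \<Longrightarrow> t \<le> \<beta> \<Longrightarrow> psi1 a1 a2 t = t - a1"
  shows "dominated y (\<lambda>t. c * psi1 a1 a2 t) \<alpha> \<beta>"
  unfolding dominated_def
proof (intro allI ballI impI)
  fix \<tau> \<xi> s \<sigma> \<delta> :: real
  assume *: "\<sigma> \<in> {1, -1}" "\<delta> \<in> {1, -1}" "\<alpha> \<le> \<xi> - s" "0 \<le> s" "\<xi> \<le> \<beta>" "c * psi1 a1 a2 \<xi> \<le> \<sigma> * y \<tau>"
  have "1 * s \<le> c * s" using * \<open>1 \<le> c\<close> by (intro mult_right_mono) auto
  moreover have "\<bar>y (\<tau> + \<delta> * s) - y \<tau>\<bar> \<le> s" using lip[of "\<tau> + \<delta> * s" \<tau>] * by auto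
  then have "\<sigma> * y \<tau> - s \<le> \<sigma> * y (\<tau> + \<delta> * s)" using *(1) by (auto simp: abs_le_iff)
  moreover have "c * psi1 a1 a2 (\<xi> - s) = c * psi1 a1 a2 \<xi> - c * s"
  proof -
    have eqs: "psi1 a1 a2 \<xi> = \<xi> - a1" "psi1 a1 a2 (\<xi> - s) = \<xi> - s - a1"
      using * by (auto intro!: lin)
    show ?thesis unfolding eqs by (simp add: algebra_simps)
  qed
  ultimately show "c * psi1 a1 a2 (\<xi> - s) \<le> \<sigma> * y (\<tau> + \<delta> * s)" using *(6) by linarith
qed

text \<open>Subtraction is truncated, so the alternatives that mention the order
  \<open>r - 2\<close> come with \<open>r \<ge> 2\<close>. For \<open>r = 1\<close> the function
  \<open>x\<close> is only locally absolutely continuous and \<open>Psi\<close> has corners; the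
  derivatives at the two points are then assumed to exist, as \<open>deriv\<close> would otherwise
  be an unspecified value.\<close>

theorem theorem2:
  fixes r :: nat and x :: "real \<Rightarrow> real" and a1 a2 l b \<tau> \<xi> :: real
  assumes "r \<ge> 1"
    and "x \<in> Linf_deriv r \<inter> Linf"
    and "a1 \<ge> 0" and "a2 \<ge> 0" and "l > 0" and "b \<noteq> 0"
    and "(a1 = 0 \<and> norms_dominated {0, r - 1, r} x (Psi r a1 a2 b l)) \<or>
         (r \<ge> 2 \<and> a2 = 0 \<and> norms_dominated {0, r - 2, r} x (Psi r a1 a2 b l)) \<or>
         (r \<ge> 2 \<and> norms_dominated {0, r - 1, r - 2, r} x (Psi r a1 a2 b l))"
    and "r = 1 \<Longrightarrow> x field_differentiable at \<tau> \<and> Psi r a1 a2 b l field_differentiable at \<xi>"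
    and "x \<tau> = Psi r a1 a2 b l \<xi>"
  shows "\<bar>deriv x \<tau>\<bar> \<le> \<bar>deriv (Psi r a1 a2 b l) \<xi>\<bar>"
proof -
  note a = \<open>a1 \<ge> 0\<close> \<open>a2 \<ge> 0\<close> and pars = \<open>a1 \<ge> 0\<close> \<open>a2 \<ge> 0\<close> \<open>l > 0\<close>
  define T where "T = a1 + a2 + 2"
  define \<omega> where "\<omega> = (2 * a1 + 2 * a2 + 4) / l"
  have \<omega>: "0 < \<omega>" unfolding \<omega>_def by (rule freq_pos[OF pars])
  note Psi_eq = Psi_eq[OF pars, folded \<omega>_def]
  \<comment> \<open>The same scaling turns the derivatives of \<open>Psi r a1 a2 b l\<close> into
    \<open>sgn b\<close> times \<open>psi k\<close>. It also gives \<open>y 1\<close> the Lipschitz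
    constant 1.\<close>
  define y where "y k t = \<omega> ^ k / \<bar>b\<bar> * (deriv ^^ (r - k)) x (t / \<omega>)" for k t
  have x_diff: "(deriv ^^ k) x field_differentiable at t" if "k < r - 1" for k t
    using assms(2) that by (auto simp: Linf_deriv_def)
  have ac: "locally_abs_continuous ((deriv ^^ (r - 1)) x)"
    using assms(2) by (auto simp: Linf_deriv_def)
  have x_cont: "continuous_on UNIV ((deriv ^^ k) x)" if "k < r" for k
  proof (cases "k = r - 1")
    case True
    then show ?thesis using locally_abs_continuous_imp_continuous[OF ac] by simp
  next
    case False
    then show ?thesis
      using x_diff[of k] that by (intro continuous_at_imp_continuous_on) (auto intro: field_differentiable_imp_continuous_at)
  qed
  have y_le: "\<bar>y k t\<bar> \<le> psi_max a1 a2 k"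
    if k: "1 \<le> k" "k \<le> r" and n: "Linf_norm ((deriv ^^ (r - k)) x) \<le> Linf_norm ((deriv ^^ (r - k)) (Psi r a1 a2 b l))" for k t
  proof -
    have "(deriv ^^ (r - k)) (Psi r a1 a2 b l) = Psi k a1 a2 b l"
      using Psi_higher_deriv[OF pars, where k = "r - k" and r = r and b = b] k by simp
    then have "Linf_norm ((deriv ^^ (r - k)) x) \<le> ereal (\<bar>b\<bar> / \<omega> ^ k * psi_max a1 a2 k)"
      using n Psi_norm_le[OF pars k(1), where b = b] unfolding \<omega>_def by (auto intro: order_trans)
    then have "\<bar>(deriv ^^ (r - k)) x (t / \<omega>)\<bar> \<le> \<bar>b\<bar> / \<omega> ^ k * psi_max a1 a2 k"
      by (rule Linf_norm_leD[rotated]) (use x_cont k in simp)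
    then have "\<omega> ^ k / \<bar>b\<bar> * \<bar>(deriv ^^ (r - k)) x (t / \<omega>)\<bar> \<le> \<omega> ^ k / \<bar>b\<bar> * (\<bar>b\<bar> / \<omega> ^ k * psi_max a1 a2 k)"
      using \<omega> by (intro mult_left_mono) auto
    then show ?thesis using \<omega> \<open>b \<noteq> 0\<close> by (simp add: y_def abs_mult)
  qed
  have dy: "(y (Suc k) has_real_derivative y k t) (at t)" if k: "1 \<le> k" "k < r" for k t
  proof -
    have r: "r - k = Suc (r - Suc k)" using k by simp
    have "((deriv ^^ (r - Suc k)) x has_real_derivative deriv ((deriv ^^ (r - Suc k)) x) s) (at s)" for s
      using x_diff[of "r - Suc k" s] k by (simp add: DERIV_deriv_iff_field_differentiable)
    then have "((\<lambda>t. \<omega> ^ Suc k / \<bar>b\<bar> * (deriv ^^ (r - Suc k)) x (t / \<omega>)) has_real_derivative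
        \<omega> ^ Suc k / \<bar>b\<bar> * (deriv ((deriv ^^ (r - Suc k)) x) (t / \<omega>) * (1 / \<omega>))) (at t)"
      using DERIV_affine_argument[where f = "(deriv ^^ (r - Suc k)) x" and D = "deriv ((deriv ^^ (r - Suc k)) x) (t / \<omega>)"
          and n = 0 and m = \<omega> and t = t and k = "\<omega> ^ Suc k / \<bar>b\<bar>"] \<omega> by simp
    then show ?thesis using \<omega> by (simp add: y_def[abs_def] r)
  qed
  have norms: "Linf_norm ((deriv ^^ r) x) \<le> Linf_norm ((deriv ^^ r) (Psi r a1 a2 b l))"
    "Linf_norm ((deriv ^^ 0) x) \<le> Linf_norm ((deriv ^^ 0) (Psi r a1 a2 b l))"
    using assms(7) unfolding norms_dominated_def by blast+
  have "Linf_norm (deriv ((deriv ^^ (r - 1)) x)) \<le> ereal \<bar>b\<bar>"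
  proof -
    have r: "r = Suc (r - 1)" using \<open>r \<ge> 1\<close> by simp
    have "(deriv ^^ r) (Psi r a1 a2 b l) = deriv ((deriv ^^ (r - 1)) (Psi r a1 a2 b l))"
      by (subst r) simp
    also have "(deriv ^^ (r - 1)) (Psi r a1 a2 b l) = Psi 1 a1 a2 b l"
      using Psi_higher_deriv[OF pars, where k = "r - 1" and r = r and b = b] \<open>r \<ge> 1\<close> by simp
    finally have "Linf_norm ((deriv ^^ r) x) \<le> Linf_norm (deriv (Psi 1 a1 a2 b l))" using norms by simp
    moreover have "(deriv ^^ r) x = deriv ((deriv ^^ (r - 1)) x)" by (subst r) simp
    ultimately show ?thesis using Psi_top_norm_le[OF pars, where b = b] by (auto intro: order_trans)
  qed
  note lip_x = locally_abs_continuous_lipschitz[OF ac this]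
  have lip: "\<bar>y 1 s - y 1 t\<bar> \<le> \<bar>s - t\<bar>" for s t
  proof -
    have "\<bar>y 1 s - y 1 t\<bar> = \<omega> / \<bar>b\<bar> * \<bar>(deriv ^^ (r - 1)) x (s / \<omega>) - (deriv ^^ (r - 1)) x (t / \<omega>)\<bar>"
      using \<omega> unfolding y_def right_diff_distrib[symmetric] by (simp add: abs_mult)
    also have "\<dots> \<le> \<omega> / \<bar>b\<bar> * (\<bar>b\<bar> * \<bar>s / \<omega> - t / \<omega>\<bar>)"
      using lip_x \<omega> by (intro mult_left_mono) auto
    also have "\<dots> = \<bar>s - t\<bar>"
      using \<omega> \<open>b \<noteq> 0\<close> by (simp add: diff_divide_distrib[symmetric])
    finally show ?thesis .
  qed
  have top: "\<bar>y r t\<bar> \<le> psi_max a1 a2 r" for t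
    using y_le[of r t] norms \<open>r \<ge> 1\<close> by simp
  have dom: "dominated (y r) (psi r a1 a2) (psi_center a1 a2 r - T / 2 - psi_rise a1 a2 r) (psi_center a1 a2 r - T / 2 + psi_rise a1 a2 r)"
    and width: "psi_width a1 a2 r = T / 2"
  proof -
    show "dominated (y r) (psi r a1 a2) (psi_center a1 a2 r - T / 2 - psi_rise a1 a2 r) (psi_center a1 a2 r - T / 2 + psi_rise a1 a2 r)"
    proof (cases "r = 1")
      case True
      \<comment> \<open>Only the first alternative admits \<open>r = 1\<close>. As
        \<open>psi1\<close> then has no plateau at zero, it is linear on all of
        \<open>{-1..1}\<close>, the branch from minimum to maximum.\<close>
      then have "a1 = 0" using assms(7) by auto
      have "dominated (y 1) (\<lambda>t. 1 * psi1 a1 a2 t) (-1) 1"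
      proof (rule psi1_dominated[OF a lip])
        show "psi1 a1 a2 t = t - a1" if "-1 \<le> t" "t \<le> 1" for t
        proof (cases "0 \<le> t")
          case True
          then show ?thesis using psi1_eq[OF a, of t] that a \<open>a1 = 0\<close> by (auto simp: psi1_base_def)
        next
          case False
          then have "psi1_base a1 a2 (t + (a1 + a2 + 2)) = - t"
            using that a \<open>a1 = 0\<close> by (auto simp: psi1_base_def)
          then show ?thesis
            using psi1_eq[OF a, of "t + (a1 + a2 + 2)"] psi1_antiperiodic[OF a, of t] False that a \<open>a1 = 0\<close> by simp
        qed
      qed auto
      then show ?thesis
        using True \<open>a1 = 0\<close> psi_1 by (simp add: psi_center_def psi_rise_def T_def field_simps)
    next
      case False
      then have "r \<ge> 2" using \<open>r \<ge> 1\<close> by simp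
      show ?thesis
      proof (rule comparison_chain[OF \<open>r \<ge> 2\<close>, where M = "psi_max a1 a2" and w = "psi_width a1 a2"])
        show "hump (psi k a1 a2) (psi_center a1 a2 k) (psi_width a1 a2 k) (psi_rise a1 a2 k) (psi_max a1 a2 k) T" if "1 \<le> k" for k
          using psi_hump[OF a that] by (simp add: T_def)
        show "psi_center a1 a2 (Suc k) = psi_center a1 a2 k + T / 2" if "1 \<le> k" for k
          using that by (cases k) (auto simp: psi_center_def T_def field_simps)
        show "(psi (Suc k) a1 a2 has_real_derivative psi k a1 a2 t) (at t)" if "1 \<le> k" for k t
          by (rule psi_deriv[OF a that])
        show "dominated (y 1) (\<lambda>t. c * psi 1 a1 a2 t) (psi_center a1 a2 1 - psi_width a1 a2 1)
            (psi_center a1 a2 1 - psi_width a1 a2 1 + psi_rise a1 a2 1)" if "1 \<le> c" for c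
          unfolding psi_1
        proof (rule psi1_dominated[OF a lip that])
          show "psi1 a1 a2 t = t - a1" if "psi_center a1 a2 1 - psi_width a1 a2 1 \<le> t"
            "t \<le> psi_center a1 a2 1 - psi_width a1 a2 1 + psi_rise a1 a2 1" for t
            using that psi1_eq[OF a, of t] a by (simp add: psi_center_def psi_width_def psi_rise_def psi1_base_def)
        qed
        \<comment> \<open>The top plateau of \<open>psi 1\<close> has length \<open>a2\<close>, that
          of \<open>psi 2\<close> has length \<open>a1\<close>. They concern the derivatives of
          \<open>x\<close> of orders \<open>r - 1\<close> and \<open>r - 2\<close>, and every
          alternative either excludes the plateau or bounds that derivative.\<close>
        show "psi_rise a1 a2 k = psi_width a1 a2 k \<or> (\<forall>t. \<bar>y k t\<bar> \<le> psi_max a1 a2 k)" if k: "1 \<le> k" "k < r" for k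
        proof -
          consider "k = 1" | "k = 2" | "k \<ge> 3" using k by linarith
          then show ?thesis
          proof cases
            case 1
            have "a2 = 0 \<or> Linf_norm ((deriv ^^ (r - 1)) x) \<le> Linf_norm ((deriv ^^ (r - 1)) (Psi r a1 a2 b l))"
              using assms(7) unfolding norms_dominated_def by blast
            then show ?thesis
              using 1 y_le[of 1] k by (auto simp: psi_rise_def psi_width_def)
          next
            case 2
            have "a1 = 0 \<or> Linf_norm ((deriv ^^ (r - 2)) x) \<le> Linf_norm ((deriv ^^ (r - 2)) (Psi r a1 a2 b l))"
              using assms(7) unfolding norms_dominated_def by blast
            then show ?thesis
              using 2 y_le[of 2] k by (auto simp: psi_rise_def psi_width_def field_simps)
          next
            case 3
            then have "k \<noteq> 1" "k - 1 \<noteq> 1" by auto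
            then show ?thesis by (simp add: psi_rise_def psi_width_def)
          qed
        qed
        show "\<exists>K. \<forall>t. \<bar>y k t\<bar> \<le> K" if "1 \<le> k" "k \<le> r" for k
          by (rule derivatives_bounded[where r = r and L = 1, OF dy top]) (use lip that in auto)
      qed (use dy top in \<open>auto simp: psi_rise_def psi_width_def psi_max_def T_def\<close>)
    qed
    show "psi_width a1 a2 r = T / 2"
      using assms(7) by (auto simp: psi_width_def T_def field_simps)
  qed
  have h: "hump (psi r a1 a2) (psi_center a1 a2 r) (T / 2) (psi_rise a1 a2 r) (psi_max a1 a2 r) T"
    using psi_hump[OF a \<open>r \<ge> 1\<close>] width by (simp add: T_def)
  have dx: "(x has_real_derivative deriv x \<tau>) (at \<tau>)"
    using x_diff[of 0 \<tau>] assms(1,8) by (cases "r = 1") (auto simp: DERIV_deriv_iff_field_differentiable)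
  have dPsi: "(Psi r a1 a2 b l has_real_derivative deriv (Psi r a1 a2 b l) \<xi>) (at \<xi>)"
  proof (cases "r = 1")
    case True
    then show ?thesis using assms(8) by (simp add: DERIV_deriv_iff_field_differentiable)
  next
    case False
    then have "(Psi (Suc (r - 1)) a1 a2 b l has_real_derivative Psi (r - 1) a1 a2 b l \<xi>) (at \<xi>)"
      using \<open>r \<ge> 1\<close> by (intro Psi_deriv[OF pars]) auto
    then show ?thesis using \<open>r \<ge> 1\<close> by (auto simp: DERIV_imp_deriv)
  qed
  define \<sigma> where "\<sigma> = sgn b"
  have \<sigma>: "\<sigma> \<in> {1, -1}" "\<bar>b\<bar> = \<sigma> * b" using \<open>b \<noteq> 0\<close> by (auto simp: \<sigma>_def sgn_if)
  \<comment> \<open>A shift by half a period absorbs the sign of \<open>b\<close>.\<close>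
  obtain \<theta> where \<theta>: "\<And>t. psi r a1 a2 (t + \<theta>) = \<sigma> * psi r a1 a2 t"
    using \<sigma>(1) hump_antiperiodic(1)[OF h] by (metis add.right_neutral insert_iff mult_1 mult_minus1 singletonD)
  have psi_Psi: "psi r a1 a2 t = \<omega> ^ r / \<bar>b\<bar> * Psi r a1 a2 b l ((t - \<theta>) / \<omega>)" for t
    using \<theta>[of "t - \<theta>"] \<omega> \<open>b \<noteq> 0\<close> \<sigma> by (auto simp: Psi_eq)
  have "\<bar>\<omega> ^ r / \<bar>b\<bar> * (deriv x \<tau> * (1 / \<omega>))\<bar> \<le> \<bar>\<omega> ^ r / \<bar>b\<bar> * (deriv (Psi r a1 a2 b l) \<xi> * (1 / \<omega>))\<bar>"
  proof (rule dominated_slope[OF h dom top])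
    show "y r (\<omega> * \<tau>) = psi r a1 a2 (\<omega> * \<xi> + \<theta>)"
      using \<omega> assms(9) by (simp add: y_def psi_Psi)
    show "(y r has_real_derivative \<omega> ^ r / \<bar>b\<bar> * (deriv x \<tau> * (1 / \<omega>))) (at (\<omega> * \<tau>))"
      using DERIV_affine_argument[where f = x and D = "deriv x \<tau>" and n = 0 and m = \<omega> and t = "\<omega> * \<tau>" and k = "\<omega> ^ r / \<bar>b\<bar>"] \<omega> dx
      by (simp add: y_def[abs_def])
    have "((\<lambda>t. \<omega> ^ r / \<bar>b\<bar> * Psi r a1 a2 b l ((t - \<theta>) / \<omega>)) has_real_derivative
        \<omega> ^ r / \<bar>b\<bar> * (deriv (Psi r a1 a2 b l) \<xi> * (1 / \<omega>))) (at (\<omega> * \<xi> + \<theta>))"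
      using \<omega> dPsi by (intro DERIV_affine_argument) auto
    then show "(psi r a1 a2 has_real_derivative \<omega> ^ r / \<bar>b\<bar> * (deriv (Psi r a1 a2 b l) \<xi> * (1 / \<omega>))) (at (\<omega> * \<xi> + \<theta>))"
      unfolding psi_Psi[symmetric] .
  qed
  then show ?thesis
    using \<omega> \<open>b \<noteq> 0\<close> by (simp add: abs_mult divide_right_mono mult_le_cancel_left_pos divide_le_cancel)
qed

end
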